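(* Let $A\subset\mathbb{R}^n$ be a semi-algebraic set. Then the Schanuel integral of the indicator function $\mathbf 1_A$ is independent of the choice of ordered basis of $\mathbb{R}^n$: for any two ordered bases $(v_n,\dots,v_1)$ and $(w_n,\dots,w_1)$ of $\mathbb{R}^n$, $$\int_{\varepsilon_{(v_n,\dots,v_1)}}\mathbf 1_A=\int_{\varepsilon_{(w_n,\dots,w_1)}}\mathbf 1_A .$$
   Context: A function $f:\mathbb R\to\mathbb R$ is called Schanuel integrable if (i) $f$ is discontinuous at only finitely many points; (ii) $f$ has (finite) left and right limits $f(x-),f(x+)$ at every $x\in\mathbb R$; (iii) the (finite) limits $f(+\infty)=\lim_{x\to+\infty}f(x)$ and $f(-\infty)=\lim_{x\to-\infty}f(x)$ exist. Its Schanuel integral is $$\int_\varepsilon f=\sum_{x\in\mathbb R}\Big(f(x)-\tfrac12 f(x-)-\tfrac12 f(x+)\Big)-\tfrac12 f(+\infty)-\tfrac12 f(-\infty)$$ (only finitely many terms of the sum are nonzero). A function $f:\mathbb R^n\to\mathbb R$ is Schanuel integrable with respect to the standard ordered basis $(e_n,\dots,e_1)$ if the functions $I_k^f:\mathbb R^k\to\mathbb R$ defined recursively by $I_n^f=f$ and $$I_{k-1}^f(a_1,\dots,a_{k-1})=\int_\varepsilon I_k^f(a_1,\dots,a_{k-1},x_k)\,dx_k\qquad(1\le k\le n)$$ are all well defined, i.e. at each stage, for every $(a_1,\dots,a_{k-1})$, the one-variable function $x_k\mapsto I_k^f(a_1,\dots,a_{k-1},x_k)$ is Schanuel integrable on $\mathbb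 R$. The integral is then $\int_\varepsilon f:=I_0^f\in\mathbb R$. For an ordered basis $(v_n,\dots,v_1)$ of $\mathbb R^n$, let $T_v:\mathbb R^n\to\mathbb R^n$ be the linear isomorphism with $T_v(e_i)=v_i$. Then $f$ is Schanuel integrable with respect to $(v_n,\dots,v_1)$ if $f\circ T_v$ is Schanuel integrable with respect to the standard ordered basis, and $\int_{\varepsilon_{(v_n,\dots,v_1)}}f:=\int_\varepsilon(f\circ T_v)$. For semi-algebraic $A\subset\mathbb R^n$, the function $\mathbf 1_A$ is Schanuel integrable with respect to every ordered basis, so both integrals in the claim are defined. *)

theory Defs
  imports "HOL-Analysis.Analysis"
begin

inductive semialgebraic :: "(real ^ 'n) set \<Rightarrow> bool" where
  zero: "real_polynomial_function p \<Longrightarrow> semialgebraic {x. p x = 0}"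
| pos: "real_polynomial_function p \<Longrightarrow> semialgebraic {x. p x > 0}"
| Un: "semialgebraic A \<Longrightarrow> semialgebraic B \<Longrightarrow> semialgebraic (A \<union> B)"
| Int: "semialgebraic A \<Longrightarrow> semialgebraic B \<Longrightarrow> semialgebraic (A \<inter> B)"
| Compl: "semialgebraic A \<Longrightarrow> semialgebraic (- A)"

definition schanuel_integrable1 :: "(real \<Rightarrow> real) \<Rightarrow> bool" where
  "schanuel_integrable1 f \<longleftrightarrow>
     finite {x. \<not> isCont f x} \<and>
     (\<forall>x. (\<exists>l. (f \<longlongrightarrow> l) (at_left x)) \<and> (\<exists>l. (f \<longlongrightarrow> l) (at_right x))) \<and>
     (\<exists>l. (f \<longlongrightarrow> l) at_top) \<and> (\<exists>l. (f \<longlongrightarrow> l) at_bot)"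

definition schanuel_jump :: "(real \<Rightarrow> real) \<Rightarrow> real \<Rightarrow> real" where
  "schanuel_jump f x = f x - Lim (at_left x) f / 2 - Lim (at_right x) f / 2"

text \<open>The sum over all reals of the jumps is taken over the points where the jump is nonzero.
  If \<open>f\<close> is integrable these are discontinuities, so there are finitely many of them;
  the value for non-integrable \<open>f\<close> has no meaning.\<close>

definition schanuel_integral1 :: "(real \<Rightarrow> real) \<Rightarrow> real" where
  "schanuel_integral1 f =
     (\<Sum>x | schanuel_jump f x \<noteq> 0. schanuel_jump f x) - Lim at_top f / 2 - Lim at_bot f / 2"

text \<open>A point \<open>(a\<^sub>1, \<dots>, a\<^sub>k)\<close> of \<open>k\<close>-space is a list of length \<open>k\<close>, so that all the spaces
  in the recursion have the same type. For \<open>f\<close> on lists of length \<open>n\<close>,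
  \<open>schanuel_iterate j f\<close> is the function \<open>I\<^sub>k\<close> with \<open>k = n - j\<close>, to be applied to lists of
  length \<open>k\<close>: it has the last \<open>j\<close> variables integrated out, starting from the last.\<close>

primrec schanuel_iterate :: "nat \<Rightarrow> (real list \<Rightarrow> real) \<Rightarrow> real list \<Rightarrow> real" where
  "schanuel_iterate 0 f = f"
| "schanuel_iterate (Suc j) f = (\<lambda>as. schanuel_integral1 (\<lambda>x. schanuel_iterate j f (as @ [x])))"

definition schanuel_integrable_std :: "nat \<Rightarrow> (real list \<Rightarrow> real) \<Rightarrow> bool" where
  "schanuel_integrable_std n f \<longleftrightarrow>
     (\<forall>k\<in>{1..n}. \<forall>as. length as = k - 1 \<longrightarrow>
        schanuel_integrable1 (\<lambda>x. schanuel_iterate (n - k) f (as @ [x])))"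

definition schanuel_integral_std :: "nat \<Rightarrow> (real list \<Rightarrow> real) \<Rightarrow> real" where
  "schanuel_integral_std n f = schanuel_iterate n f []"

text \<open>An ordered basis is given as the list \<open>[v\<^sub>1, \<dots>, v\<^sub>n]\<close>; the ordered basis written
  \<open>(v\<^sub>n, \<dots>, v\<^sub>1)\<close>, whose coordinates are integrated out in the order \<open>x\<^sub>n, \<dots>, x\<^sub>1\<close>.\<close>

definition ordered_basis :: "(real ^ 'n) list \<Rightarrow> bool" where
  "ordered_basis vs \<longleftrightarrow> distinct vs \<and> independent (set vs) \<and> span (set vs) = UNIV"

definition basis_map :: "(real ^ 'n) list \<Rightarrow> real list \<Rightarrow> real ^ 'n" where
  "basis_map vs as = (\<Sum>i<CARD('n). as ! i *\<^sub>R vs ! i)"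

definition schanuel_integrable :: "(real ^ 'n) list \<Rightarrow> (real ^ 'n \<Rightarrow> real) \<Rightarrow> bool" where
  "schanuel_integrable vs f \<longleftrightarrow> schanuel_integrable_std CARD('n) (f \<circ> basis_map vs)"

definition schanuel_integral :: "(real ^ 'n) list \<Rightarrow> (real ^ 'n \<Rightarrow> real) \<Rightarrow> real" where
  "schanuel_integral vs f = schanuel_integral_std CARD('n) (f \<circ> basis_map vs)"

end

theory Submission
  imports Defs "HOL-Computational_Algebra.Polynomial"
begin

text \<open>The one-dimensional Schanuel integral is the Euler characteristic with compact supports: it is
  linear, and gives \<open>1\<close> on a point and \<open>- 1\<close> on an open interval. In particular it is invariant under
  homeomorphisms of the line. Call a function on \<open>n\<close>-space sign-determined if it depends only on the
  signs of finitely many polynomials. By the Cohen--Hoermander argument, two parameters at which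
  finitely many suitable polynomials have the same signs have sections related by an increasing
  homeomorphism, so integrating out a coordinate preserves sign-determined functions.

  For two coordinates the order of integration is irrelevant: off finitely many vertical lines the
  plane is cut by graphs of continuous functions that are strictly monotone or constant, and the two
  iterated integrals are compared on each piece. Invariance under invertible linear maps follows,
  since these are generated by coordinate scalings (one-dimensional invariance), coordinate swaps
  (order of integration) and shears (integrate the sheared coordinate first; translation invariance).\<close>

section \<open>The one-dimensional integral\<close>

text \<open>Indicators alone are not a stable class, since integrating out a coordinate produces
  other values than 0 and 1. Sign-determined functions are stable, and their sections are step
  functions, for which every linear claim is checked on constants, points and rays. The obstacle is
  that sections vary with the parameter. No cylindrical decomposition is set up; instead a finite
  family of polynomials is closed under derivative, dropping the top term, and remainder. Actual
  degrees may jump with the parameter, hence the truncations and a division that avoids inverting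
  leading coefficients. The homeomorphism between two sections grows by induction on the formal
  degree: remainders give the sign of a new polynomial at the roots of earlier members, and its
  derivative, being earlier, makes it monotone between them. The same homeomorphisms serve in the
  plane. Over a strip they straighten the function, and the images of the roots of one section are
  the curves that bound the pieces. Monotone or constant curves are wanted because the horizontal
  sections of each piece are then intervals or points again.\<close>

lemma tendsto_Lim_exists:
  fixes f :: "real \<Rightarrow> real"
  assumes "\<exists>l. (f \<longlongrightarrow> l) F" "F \<noteq> bot"
  shows "(f \<longlongrightarrow> Lim F f) F"
  using assms tendsto_Lim[of F f] by auto

lemma schanuel_integrable1D:
  assumes "schanuel_integrable1 f"
  shows "(f \<longlongrightarrow> Lim (at_left x) f) (at_left x)" "(f \<longlongrightarrow> Lim (at_right x) f) (at_right x)"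
    "(f \<longlongrightarrow> Lim at_top f) at_top" "(f \<longlongrightarrow> Lim at_bot f) at_bot"
    "finite {x. \<not> isCont f x}"
  using assms unfolding schanuel_integrable1_def
  by (auto intro!: tendsto_Lim_exists)

lemma schanuel_jump_isCont:
  assumes "isCont f x" shows "schanuel_jump f x = 0"
proof -
  have "(f \<longlongrightarrow> f x) (at_left x)" "(f \<longlongrightarrow> f x) (at_right x)"
    using assms unfolding isCont_def by (auto simp: filterlim_at_split)
  then have "Lim (at_left x) f = f x" "Lim (at_right x) f = f x"
    by (auto intro!: tendsto_Lim)
  then show ?thesis by (simp add: schanuel_jump_def)
qed

lemma schanuel_integral1_superset:
  assumes "finite S" "{x. \<not> isCont f x} \<subseteq> S"
  shows "schanuel_integral1 f = (\<Sum>x\<in>S. schanuel_jump f x) - Lim at_top f / 2 - Lim at_bot f / 2"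
proof -
  have "(\<Sum>x | schanuel_jump f x \<noteq> 0. schanuel_jump f x) = (\<Sum>x\<in>S. schanuel_jump f x)"
    using assms schanuel_jump_isCont by (intro sum.mono_neutral_left) auto
  then show ?thesis by (simp add: schanuel_integral1_def)
qed

lemma schanuel1_linear:
  assumes f: "schanuel_integrable1 f" and g: "schanuel_integrable1 g"
  shows "schanuel_integrable1 (\<lambda>x. a * f x + b * g x)" (is "schanuel_integrable1 ?h")
    and "schanuel_integral1 (\<lambda>x. a * f x + b * g x) = a * schanuel_integral1 f + b * schanuel_integral1 g"
proof -
  note lf = schanuel_integrable1D[OF f] and lg = schanuel_integrable1D[OF g]
  have lim: "(?h \<longlongrightarrow> a * Lim F f + b * Lim F g) F"
    if "(f \<longlongrightarrow> Lim F f) F" "(g \<longlongrightarrow> Lim F g) F" for F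
    by (intro tendsto_intros that)
  let ?S = "{x. \<not> isCont f x} \<union> {x. \<not> isCont g x}"
  have fin: "finite ?S" using lf(5) lg(5) by simp
  have sub: "{x. \<not> isCont ?h x} \<subseteq> ?S"
    by (auto intro!: continuous_intros)
  show "schanuel_integrable1 ?h"
    unfolding schanuel_integrable1_def
    using finite_subset[OF sub fin] lim[OF lf(1) lg(1)] lim[OF lf(2) lg(2)] lim[OF lf(3) lg(3)] lim[OF lf(4) lg(4)]
    by blast
  have jump: "schanuel_jump ?h x = a * schanuel_jump f x + b * schanuel_jump g x" for x
    using tendsto_Lim[OF _ lim[OF lf(1) lg(1)], of x] tendsto_Lim[OF _ lim[OF lf(2) lg(2)], of x]
    by (simp add: schanuel_jump_def algebra_simps add_divide_distrib)
  show "schanuel_integral1 ?h = a * schanuel_integral1 f + b * schanuel_integral1 g"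
    using tendsto_Lim[OF _ lim[OF lf(3) lg(3)]] tendsto_Lim[OF _ lim[OF lf(4) lg(4)]]
    by (simp add: schanuel_integral1_superset[OF fin, of f] schanuel_integral1_superset[OF fin, of g]
          schanuel_integral1_superset[OF fin sub] jump sum.distrib sum_distrib_left[symmetric] algebra_simps add_divide_distrib)
qed

lemma schanuel1_const:
  "schanuel_integrable1 (\<lambda>_. c)" "schanuel_integral1 (\<lambda>_. c) = - c"
proof -
  show "schanuel_integrable1 (\<lambda>_. c)"
    unfolding schanuel_integrable1_def by auto
  show "schanuel_integral1 (\<lambda>_. c) = - c"
    using schanuel_integral1_superset[of "{}" "\<lambda>_. c"]
    by (simp add: tendsto_Lim[OF _ tendsto_const])
qed

lemmas schanuel1_add = schanuel1_linear[where a = 1 and b = 1, simplified]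
lemmas schanuel1_cmult = schanuel1_linear[where b = 0, OF _ schanuel1_const(1)[of 0], simplified]

lemma isCont_off_point:
  fixes f g :: "real \<Rightarrow> real"
  assumes "open S" "x \<in> S" "\<And>y. y \<in> S \<Longrightarrow> f y = c"
  shows "isCont f x"
proof -
  have "eventually (\<lambda>y. f y = c) (nhds x)"
    using eventually_nhds_in_open[OF assms(1,2)] by (rule eventually_mono) (use assms in auto)
  then show ?thesis using isCont_cong[of f "\<lambda>_. c"] by simp
qed

text \<open>Each of \<open>l\<close> and \<open>r\<close> is subtracted in two halves, once as a
  one-sided limit at \<open>a\<close> and once as a limit at infinity. Points and both kinds of rays
  are special cases.\<close>

lemma schanuel1_one_breakpoint:
  fixes f :: "real \<Rightarrow> real"
  assumes l: "\<And>y. y < a \<Longrightarrow> f y = l" and r: "\<And>y. y > a \<Longrightarrow> f y = r"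
  shows "schanuel_integrable1 f" "schanuel_integral1 f = f a - l - r"
proof -
  have cont: "isCont f x" if "x \<noteq> a" for x
    using that isCont_off_point[of "{..<a}" x f l] isCont_off_point[of "{a<..}" x f r] l r
    by (cases "x < a") auto
  have sub: "{x. \<not> isCont f x} \<subseteq> {a}" using cont by auto
  have la: "(f \<longlongrightarrow> l) (at_left a)"
    by (rule tendsto_eventually) (auto simp: eventually_at_filter l)
  have ra: "(f \<longlongrightarrow> r) (at_right a)"
    by (rule tendsto_eventually) (auto simp: eventually_at_filter r)
  have top: "(f \<longlongrightarrow> r) at_top"
    by (rule tendsto_eventually, rule eventually_mono[OF eventually_gt_at_top[of a]]) (rule r)
  have bot: "(f \<longlongrightarrow> l) at_bot"
    by (rule tendsto_eventually, rule eventually_mono[OF eventually_le_at_bot[of "a - 1"]]) (auto intro: l)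
  have lr: "(\<exists>l. (f \<longlongrightarrow> l) (at_left x)) \<and> (\<exists>l. (f \<longlongrightarrow> l) (at_right x))" for x
    using la ra cont[of x] unfolding isCont_def by (cases "x = a") (auto simp: filterlim_at_split)
  show "schanuel_integrable1 f"
    unfolding schanuel_integrable1_def
    using finite_subset[OF sub] lr top bot by blast
  show "schanuel_integral1 f = f a - l - r"
    using schanuel_integral1_superset[OF _ sub] tendsto_Lim[OF _ la] tendsto_Lim[OF _ ra]
      tendsto_Lim[OF _ top] tendsto_Lim[OF _ bot]
    by (simp add: schanuel_jump_def)
qed

lemma schanuel1_point:
  "schanuel_integrable1 (\<lambda>y. if y = a then 1 else 0)" "schanuel_integral1 (\<lambda>y. if y = a then 1 else 0) = 1"
  using schanuel1_one_breakpoint[of a "\<lambda>y. if y = a then 1 else 0" 0 0] by auto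

lemma schanuel1_less:
  "schanuel_integrable1 (\<lambda>y. if y < a then 1 else 0)" "schanuel_integral1 (\<lambda>y. if y < a then 1 else 0) = -1"
  using schanuel1_one_breakpoint[of a "\<lambda>y. if y < a then 1 else 0" 1 0] by auto

lemma schanuel1_greater:
  "schanuel_integrable1 (\<lambda>y. if y > a then 1 else 0)" "schanuel_integral1 (\<lambda>y. if y > a then 1 else 0) = -1"
  using schanuel1_one_breakpoint[of a "\<lambda>y. if y > a then 1 else 0" 0 1] by auto

section \<open>Open intervals and step functions on the line\<close>

lemma open_convex_real_cases:
  fixes J :: "real set"
  assumes "open J" "convex J" "J \<noteq> {}"
  obtains "J = UNIV" | b where "J = {..<b}" | a where "J = {a<..}" | a b where "a < b" "J = {a<..<b}"
proof -
  obtain x where x: "x \<in> J" using assms by auto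
  have iv: "z \<in> J" if "y \<in> J" "w \<in> J" "y \<le> z" "z \<le> w" for y z w
    using assms(2) that unfolding is_interval_convex_1[symmetric] is_interval_1 by blast
  have no_max: "\<exists>w\<in>J. y < w" and no_min: "\<exists>w\<in>J. w < y" if y: "y \<in> J" for y
  proof -
    obtain e where "e > 0" "ball y e \<subseteq> J" using assms(1) y openE by blast
    then have "y + e/2 \<in> J" "y - e/2 \<in> J" by (auto simp: subset_iff dist_real_def)
    then show "\<exists>w\<in>J. y < w" "\<exists>w\<in>J. w < y"
      using \<open>e > 0\<close> by (force intro!: bexI[of _ "y + e/2"], force intro!: bexI[of _ "y - e/2"])
  qed
  have up: "z \<in> J \<longleftrightarrow> z < Sup J" if "bdd_above J" "z \<ge> x" for z
  proof
    assume "z \<in> J" then show "z < Sup J" using no_max that(1) cSup_upper by (meson less_le_trans)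
  next
    assume "z < Sup J" then obtain w where "w \<in> J" "z < w" using less_cSupE assms(3) by metis
    then show "z \<in> J" using iv[OF x] that by auto
  qed
  have up': "z \<in> J" if "\<not> bdd_above J" "z \<ge> x" for z
    using that iv[OF x] unfolding bdd_above_def by (meson linear)
  have dn: "z \<in> J \<longleftrightarrow> z > Inf J" if "bdd_below J" "z \<le> x" for z
  proof
    assume "z \<in> J" then show "z > Inf J" using no_min that(1) cInf_lower by (meson le_less_trans)
  next
    assume "z > Inf J" then obtain w where "w \<in> J" "z > w" using cInf_lessD assms(3) by metis
    then show "z \<in> J" using iv[OF _ x] that by auto
  qed
  have dn': "z \<in> J" if "\<not> bdd_below J" "z \<le> x" for z
    using that iv[OF _ x] unfolding bdd_below_def by (meson linear)
  have xs: "bdd_above J \<Longrightarrow> x < Sup J" and xi: "bdd_below J \<Longrightarrow> x > Inf J" using up[of x] dn[of x] x by auto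
  show ?thesis
  proof (cases "bdd_above J"; cases "bdd_below J")
    assume a: "bdd_above J" "bdd_below J"
    have "z \<in> J \<longleftrightarrow> z \<in> {Inf J<..<Sup J}" for z
      using up[OF a(1), of z] dn[OF a(2), of z] xs[OF a(1)] xi[OF a(2)] by (cases "z \<le> x") auto
    then have "J = {Inf J<..<Sup J}" by blast
    then show ?thesis using that(4)[of "Inf J" "Sup J"] xs[OF a(1)] xi[OF a(2)] by linarith
  next
    assume a: "bdd_above J" "\<not> bdd_below J"
    have "z \<in> J \<longleftrightarrow> z \<in> {..<Sup J}" for z
      using up[OF a(1), of z] dn'[OF a(2), of z] xs[OF a(1)] by (cases "z \<le> x") auto
    then show ?thesis using that(2) by blast
  next
    assume a: "\<not> bdd_above J" "bdd_below J"
    have "z \<in> J \<longleftrightarrow> z \<in> {Inf J<..}" for z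
      using up'[OF a(1), of z] dn[OF a(2), of z] xi[OF a(2)] by (cases "z \<le> x") auto
    then show ?thesis using that(3) by blast
  next
    assume a: "\<not> bdd_above J" "\<not> bdd_below J"
    have "z \<in> J" for z
      using up'[OF a(1), of z] dn'[OF a(2), of z] by (cases "z \<le> x") auto
    then show ?thesis using that(1) by blast
  qed
qed

lemma schanuel1_open_convex:
  fixes J :: "real set"
  assumes "open J" "convex J"
  shows "schanuel_integrable1 (\<lambda>y. if y \<in> J then 1 else 0)"
    "schanuel_integral1 (\<lambda>y. if y \<in> J then 1 else 0) = (if J = {} then 0 else - 1)"
proof -
  have "schanuel_integrable1 (\<lambda>y. if y \<in> J then 1 else 0) \<and>
    schanuel_integral1 (\<lambda>y. if y \<in> J then 1 else 0) = (if J = {} then 0 else - 1)"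
  proof (cases "J = {}")
    case True
    then show ?thesis using schanuel1_const[of 0] by simp
  next
    case False
    show ?thesis
    proof (rule open_convex_real_cases[OF assms False])
      assume "J = UNIV" then show ?thesis using schanuel1_const[of 1] by simp
    next
      fix b assume "J = {..<b}"
      then show ?thesis using schanuel1_less[of b] by auto
    next
      fix a assume "J = {a<..}"
      then show ?thesis using schanuel1_greater[of a] by auto
    next
      fix a b :: real assume J: "a < b" "J = {a<..<b}"
      let ?p = "\<lambda>y. if y = a then 1 else 0 :: real" and ?a = "\<lambda>y. if y < a then 1 else 0 :: real"
        and ?b = "\<lambda>y. if y < b then 1 else 0 :: real"
      \<comment> \<open>A bounded open interval is the ray below \<open>b\<close> without the ray
        below \<open>a\<close> and without the point \<open>a\<close>, so its integral is -1 + 1 -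
        1.\<close>
      have eq: "(\<lambda>y. if y \<in> J then 1 else 0) = (\<lambda>y. 1 * (1 * ?b y + (-1) * ?a y) + (-1) * ?p y)"
        using J by auto
      have 1: "schanuel_integrable1 (\<lambda>y. 1 * ?b y + (-1) * ?a y)"
        "schanuel_integral1 (\<lambda>y. 1 * ?b y + (-1) * ?a y) = 1 * (-1) + (-1) * (-1)"
        using schanuel1_linear[OF schanuel1_less(1)[of b] schanuel1_less(1)[of a], of 1 "-1"]
          schanuel1_less(2)[of a] schanuel1_less(2)[of b] by metis+
      show ?thesis
        unfolding eq using schanuel1_linear[OF 1(1) schanuel1_point(1)[of a], of 1 "-1"] 1(2)
          schanuel1_point(2)[of a] False by simp
    qed
  qed
  then show "schanuel_integrable1 (\<lambda>y. if y \<in> J then 1 else 0)"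
    "schanuel_integral1 (\<lambda>y. if y \<in> J then 1 else 0) = (if J = {} then 0 else - 1)" by auto
qed

text \<open>Given by generators, so that a claim compatible with linear combinations has to be
  checked only on constants, points and left rays. Right rays are the constant 1 minus a left ray
  and a point.\<close>

inductive step_fun :: "real set \<Rightarrow> (real \<Rightarrow> real) \<Rightarrow> bool" for Z where
  const: "step_fun Z (\<lambda>_. c)"
| point: "z \<in> Z \<Longrightarrow> step_fun Z (\<lambda>y. if y = z then 1 else 0)"
| ray: "z \<in> Z \<Longrightarrow> step_fun Z (\<lambda>y. if y < z then 1 else 0)"
| add: "step_fun Z s \<Longrightarrow> step_fun Z t \<Longrightarrow> step_fun Z (\<lambda>y. s y + t y)"
| cmult: "step_fun Z s \<Longrightarrow> step_fun Z (\<lambda>y. c * s y)"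

lemma step_fun_mono: "step_fun Z s \<Longrightarrow> Z \<subseteq> Z' \<Longrightarrow> step_fun Z' s"
  by (induction rule: step_fun.induct) (auto intro: step_fun.intros)

lemma step_funI:
  fixes Z :: "real set"
  assumes "finite Z" "\<And>y y'. (\<And>z. z \<in> Z \<Longrightarrow> sgn (y - z) = sgn (y' - z)) \<Longrightarrow> s y = s y'"
  shows "step_fun Z s"
  using assms
proof (induction Z arbitrary: s rule: finite_linorder_max_induct)
  case empty
  then have "s = (\<lambda>_. s 0)" by auto
  then show ?case using step_fun.const by metis
next
  case (insert m Z)
  obtain \<mu> where \<mu>: "\<mu> < m" "\<And>z. z \<in> Z \<Longrightarrow> z < \<mu>"
  proof (cases "Z = {}")
    case False
    then have "Max Z < m" using insert.hyps by auto
    then obtain \<mu> where "Max Z < \<mu>" "\<mu> < m" using dense by blast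
    then show ?thesis using that False insert.hyps by auto
  qed (use that[of "m - 1"] in auto)
  \<comment> \<open>\<open>s'\<close> prolongs to the right the value that \<open>s\<close> takes
    between \<open>Z\<close> and \<open>m\<close>, so \<open>m\<close> is no breakpoint of
    \<open>s'\<close>. What is left of \<open>s\<close> is constant on each side of \<open>m\<close>
    and vanishes to its left.\<close>
  define s' where "s' = (\<lambda>y. s (min y \<mu>))"
  have "step_fun Z s'"
  proof (rule insert.IH)
    fix y y' assume y: "\<And>z. z \<in> Z \<Longrightarrow> sgn (y - z) = sgn (y' - z)"
    show "s' y = s' y'" unfolding s'_def
    proof (rule insert.prems)
      fix z assume z: "z \<in> insert m Z"
      show "sgn (min y \<mu> - z) = sgn (min y' \<mu> - z)"
      proof (cases "z = m")
        case True
        then show ?thesis using \<mu>(1) by (auto simp: min_def sgn_if)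
      next
        case False
        with z y[of z] \<mu>(2)[of z] show ?thesis
          by (auto simp: min_def sgn_if split: if_splits)
      qed
    qed
  qed
  then have s': "step_fun (insert m Z) s'" using step_fun_mono by blast
  have big: "s y = s (m + 1)" if "y > m" for y
    by (rule insert.prems) (use that insert.hyps in \<open>force simp: sgn_if\<close>)
  have mid: "s y = s' y" if "y < m" for y
    unfolding s'_def
    by (rule insert.prems) (use that \<mu> in \<open>force simp: sgn_if min_def\<close>)
  have "s = (\<lambda>y. (s' y + (s m - s (m + 1)) * (if y = m then 1 else 0))
        + ((s (m + 1) - s \<mu>) + (s \<mu> - s (m + 1)) * (if y < m then 1 else 0)))" (is "s = ?r")
  proof
    fix y
    have s'_big: "s' y = s \<mu>" if "y \<ge> m" for y
      using that \<mu>(1) by (simp add: s'_def min_def)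
    consider "y < m" | "y = m" | "y > m" by linarith
    then show "s y = ?r y"
    proof cases
      case 1
      then show ?thesis by (simp add: mid[OF 1])
    next
      case 2
      then show ?thesis using s'_big[of m] by simp
    next
      case 3
      then have "y \<noteq> m" "\<not> y < m" "s' y = s \<mu>" "s y = s (m + 1)" using s'_big[of y] big[of y] by auto
      then show ?thesis by (simp only: if_False)
    qed
  qed
  moreover have "step_fun (insert m Z) ?r"
    by (intro step_fun.intros s') auto
  ultimately show ?case by metis
qed

lemma step_fun_integrable: "step_fun Z s \<Longrightarrow> schanuel_integrable1 s"
proof (induction rule: step_fun.induct)
  case (add s t)
  show ?case by (rule schanuel1_add(1)[OF add.IH])
next
  case (cmult s c)
  show ?case by (rule schanuel1_cmult(1)[OF cmult.IH])
qed (rule schanuel1_const schanuel1_point schanuel1_less)+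

text \<open>A point pulls back to a point and a ray to a nonempty open interval, whose integral is
  -1 whatever its shape. So \<open>\<phi>\<close> may reverse the order, as negative scalings
  do.\<close>

lemma schanuel1_step_comp:
  fixes \<phi> :: "real \<Rightarrow> real"
  assumes "step_fun Z s" and bij: "bij \<phi>" and cont: "continuous_on UNIV \<phi>"
  shows "schanuel_integrable1 (\<lambda>x. s (\<phi> x)) \<and> schanuel_integral1 (\<lambda>x. s (\<phi> x)) = schanuel_integral1 s"
  using assms(1)
proof (induction rule: step_fun.induct)
  case (const c)
  then show ?case using schanuel1_const by simp
next
  case (point z)
  have "(\<phi> x = z) = (x = inv \<phi> z)" for x
    using bij by (metis bij_inv_eq_iff)
  then show ?case using schanuel1_point by simp
next
  case (ray z)
  let ?J = "\<phi> -` {..<z}"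
  have "inj \<phi>" "surj \<phi>" using bij by (auto simp: bij_def)
  then have mono: "strict_mono \<phi> \<or> strict_antimono_on UNIV \<phi>"
    using injective_eq_monotone_map[of UNIV \<phi>] cont by auto
  have "open ?J" using cont by (intro open_vimage) auto
  moreover have "is_interval ?J"
    using mono unfolding is_interval_1
    by (auto simp: monotone_on_def) (metis less_le_trans le_less_trans order_le_less)+
  moreover have "?J \<noteq> {}" 
    using \<open>surj \<phi>\<close> by (metis vimage_eq lessThan_iff lt_ex surjD empty_iff)
  ultimately show ?case using schanuel1_open_convex[of ?J] schanuel1_less[of z]
    by (simp add: is_interval_convex_1)
next
  case (add s t)
  then show ?case
    using schanuel1_add[of "\<lambda>x. s (\<phi> x)" "\<lambda>x. t (\<phi> x)"]
      schanuel1_add(2)[OF add.hyps[THEN step_fun_integrable]] by auto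
next
  case (cmult s c)
  then show ?case
    using schanuel1_cmult[of "\<lambda>x. s (\<phi> x)" c]
      schanuel1_cmult(2)[OF cmult.hyps[THEN step_fun_integrable]] by auto
qed

section \<open>Order isomorphisms matching the signs of two polynomials\<close>

lemma strict_mono_surj_isCont:
  fixes \<phi> :: "real \<Rightarrow> real"
  assumes "strict_mono \<phi>" "surj \<phi>"
  shows "continuous_on UNIV \<phi>"
proof (rule continuous_onI_mono)
  show "open (\<phi> ` UNIV)" using assms by simp
  show "\<And>x y. x \<in> UNIV \<Longrightarrow> y \<in> UNIV \<Longrightarrow> x \<le> y \<Longrightarrow> \<phi> x \<le> \<phi> y"
    using assms strict_mono_less_eq by blast
qed

text \<open>Piecewise linear homeomorphisms are composed from these: each changes the slope at a
  single place and leaves everything to its left alone.\<close>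

definition kink :: "real \<Rightarrow> real \<Rightarrow> real \<Rightarrow> real" where
  "kink c s x = (if x \<le> c then x else c + s * (x - c))"

lemma strict_mono_kink: "s > 0 \<Longrightarrow> strict_mono (kink c s)"
proof (rule strict_monoI)
  fix x y :: real assume "s > 0" "x < y"
  then have "s * (x - c) < s * (y - c)" by simp
  moreover have "y > c \<Longrightarrow> s * (y - c) > 0" using \<open>s > 0\<close> by simp
  ultimately show "kink c s x < kink c s y"
    using \<open>x < y\<close> by (auto simp: kink_def)
qed

lemma surj_kink: "s > 0 \<Longrightarrow> surj (kink c s)"
proof (rule surjI)
  fix y assume "s > 0"
  then show "kink c s (kink c (1/s) y) = y"
    by (auto simp: kink_def field_simps)
qed

text \<open>Only a crossing leaves any freedom: then \<open>f\<close> and \<open>g\<close> each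
  vanish once inside, at \<open>z\<close> and \<open>z'\<close>, and a map carrying \<open>z\<close>
  to \<open>z'\<close> matches the signs. Otherwise the endpoint signs force the same sign on the
  whole interior, and the identity serves.\<close>

lemma increasing_sign_match:
  fixes f g :: "real \<Rightarrow> real"
  assumes "l < u"
    and cont: "continuous_on {l..u} f" "continuous_on {l..u} g"
    and mono: "strict_mono_on {l..u} f" "strict_mono_on {l..u} g"
    and sgn: "sgn (f l) = sgn (g l)" "sgn (f u) = sgn (g u)"
  shows "\<exists>\<theta>. strict_mono \<theta> \<and> surj \<theta> \<and> (\<forall>x. x \<le> l \<or> u \<le> x \<longrightarrow> \<theta> x = x) \<and>
    (\<forall>x\<in>{l..u}. sgn (f x) = sgn (g (\<theta> x)))"
proof (cases "f l < 0 \<and> f u > 0")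
  case True
  then have g: "g l < 0" "g u > 0" using sgn by (auto simp: sgn_if split: if_splits)
  obtain z where z: "z \<in> {l..u}" "f z = 0"
    using IVT'[of f l 0 u] True \<open>l < u\<close> cont(1) by auto
  obtain z' where z': "z' \<in> {l..u}" "g z' = 0"
    using IVT'[of g l 0 u] g \<open>l < u\<close> cont(2) by auto
  have zlu: "l < z" "z < u" "l < z'" "z' < u"
    using z z' True g by (auto simp: order_le_less)
  \<comment> \<open>\<open>s1\<close> stretches from \<open>l\<close> so that \<open>z\<close> lands
    on \<open>z'\<close>; this carries \<open>u\<close> to \<open>u1\<close>. Bending at
    \<open>z'\<close> with factor \<open>s2\<close> brings \<open>u1\<close> back to
    \<open>u\<close>, and \<open>s3\<close> restores slope 1 beyond \<open>u\<close>, so that the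
    composite is the identity there.\<close>
  define s1 where "s1 = (z' - l) / (z - l)"
  define u1 where "u1 = l + s1 * (u - l)"
  define s2 where "s2 = (u - z') / (u1 - z')"
  define s3 where "s3 = 1 / (s1 * s2)"
  have s1: "s1 > 0" using zlu by (simp add: s1_def)
  have s1z: "l + s1 * (z - l) = z'" using zlu by (simp add: s1_def field_simps)
  have u1: "u1 > z'"
  proof -
    have "s1 * (u - l) > s1 * (z - l)" using s1 zlu by simp
    then show ?thesis using s1z by (simp add: u1_def)
  qed
  have s2: "s2 > 0" using zlu u1 by (simp add: s2_def)
  have s3: "s3 > 0" using s1 s2 by (simp add: s3_def)
  have s2u: "z' + s2 * (u1 - z') = u" using u1 by (simp add: s2_def)
  define \<theta> where "\<theta> = kink u s3 \<circ> kink z' s2 \<circ> kink l s1"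
  have mono\<theta>: "strict_mono \<theta>"
    unfolding \<theta>_def comp_def
    by (intro strict_monoI strict_monoD[OF strict_mono_kink] s1 s2 s3)
  have surj\<theta>: "surj \<theta>"
    unfolding \<theta>_def by (intro comp_surj surj_kink s1 s2 s3)
  have low: "\<theta> x = x" if "x \<le> l" for x
    using that zlu by (simp add: \<theta>_def kink_def)
  have at_z: "\<theta> z = z'"
    using zlu s1z by (simp add: \<theta>_def kink_def)
  have at_u: "\<theta> u = u"
  proof -
    have "kink l s1 u = u1" using zlu by (simp add: kink_def u1_def)
    moreover have "kink z' s2 u1 = u" using u1 s2u by (simp add: kink_def)
    ultimately show ?thesis by (simp add: \<theta>_def kink_def)
  qed
  have high: "\<theta> x = x" if "u < x" for x
  proof -
    have "s1 * (x - u) > 0" using that s1 by simp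
    moreover have 1: "kink l s1 x = u1 + s1 * (x - u)" using that zlu by (simp add: kink_def u1_def algebra_simps)
    ultimately have "kink z' s2 (kink l s1 x) = z' + s2 * (u1 + s1 * (x - u) - z')"
      using u1 by (simp add: kink_def)
    also have "\<dots> = u + s1 * s2 * (x - u)" using s2u by (simp add: algebra_simps)
    finally have "kink z' s2 (kink l s1 x) = u + s1 * s2 * (x - u)" .
    moreover have "s1 * s2 * (x - u) > 0" using that s1 s2 by simp
    ultimately show ?thesis using s1 s2 by (simp add: \<theta>_def kink_def s3_def)
  qed
  have "sgn (f x) = sgn (g (\<theta> x))" if x: "x \<in> {l..u}" for x
  proof -
    have \<theta>x: "\<theta> x \<in> {l..u}"
      using x low[of l] at_u strict_mono_less_eq[OF mono\<theta>, of l x] strict_mono_less_eq[OF mono\<theta>, of x u] by auto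
    consider "x < z" | "x = z" | "x > z" by linarith
    then show ?thesis
    proof cases
      case 1
      then have "f x < 0" using mono(1) x z by (metis strict_mono_onD)
      moreover have "\<theta> x < z'" using 1 at_z mono\<theta> strict_monoD by metis
      then have "g (\<theta> x) < 0" using mono(2) \<theta>x z' by (metis strict_mono_onD)
      ultimately show ?thesis by simp
    next
      case 2
      then show ?thesis using at_z z z' by simp
    next
      case 3
      then have "f x > 0" using mono(1) x z by (metis strict_mono_onD)
      moreover have "\<theta> x > z'" using 3 at_z mono\<theta> strict_monoD by metis
      then have "g (\<theta> x) > 0" using mono(2) \<theta>x z' by (metis strict_mono_onD)
      ultimately show ?thesis by simp
    qed
  qed
  moreover have "\<forall>x. x \<le> l \<or> u \<le> x \<longrightarrow> \<theta> x = x" using low high at_u by (auto simp: order_le_less)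
  ultimately show ?thesis using mono\<theta> surj\<theta> by blast
next
  case False
  have "sgn (f x) = sgn (g x)" if x: "x \<in> {l..u}" for x
  proof -
    consider "x = l" | "x = u" | "l < x" "x < u" using x by fastforce
    then show ?thesis
    proof cases
      case 3
      have "f l < f x" "f x < f u" "g l < g x" "g x < g u"
        using 3 mono \<open>l < u\<close> by (auto intro: strict_mono_onD)
      moreover have "f l \<ge> 0 \<and> g l \<ge> 0 \<or> f u \<le> 0 \<and> g u \<le> 0"
        using False sgn sgn_less[of "f l"] sgn_less[of "g l"] sgn_greater[of "f u"] sgn_greater[of "g u"]
        by linarith
      ultimately show ?thesis by (elim disjE) simp_all
    qed (use sgn in auto)
  qed
  moreover have "strict_mono (\<lambda>x::real. x)" by (simp add: strict_mono_def)
  ultimately show ?thesis by (intro exI[of _ "\<lambda>x. x"]) auto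
qed

lemma monotone_sign_match:
  fixes f g :: "real \<Rightarrow> real"
  assumes "l < u"
    and cont: "continuous_on {l..u} f" "continuous_on {l..u} g"
    and mono: "strict_mono_on {l..u} f \<and> strict_mono_on {l..u} g \<or>
      strict_antimono_on {l..u} f \<and> strict_antimono_on {l..u} g"
    and sgn: "sgn (f l) = sgn (g l)" "sgn (f u) = sgn (g u)"
  shows "\<exists>\<theta>. strict_mono \<theta> \<and> surj \<theta> \<and> (\<forall>x. x \<le> l \<or> u \<le> x \<longrightarrow> \<theta> x = x) \<and>
    (\<forall>x\<in>{l..u}. sgn (f x) = sgn (g (\<theta> x)))"
  using mono
proof
  assume "strict_mono_on {l..u} f \<and> strict_mono_on {l..u} g"
  then show ?thesis using increasing_sign_match assms by blast
next
  assume "strict_antimono_on {l..u} f \<and> strict_antimono_on {l..u} g"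
  then have "strict_mono_on {l..u} (\<lambda>x. - f x)" "strict_mono_on {l..u} (\<lambda>x. - g x)"
    by (auto simp: monotone_on_def)
  then show ?thesis
    using increasing_sign_match[of l u "\<lambda>x. - f x" "\<lambda>x. - g x"] assms
    by (simp add: continuous_on_minus sgn_minus)
qed

text \<open>A map for one gap is the identity outside it, so the maps for successive gaps compose
  without disturbing each other. The claim stops at \<open>Max Z\<close>, so that a new largest
  point brings exactly one further gap.\<close>

lemma glue_sign_match:
  fixes f g :: "real \<Rightarrow> real" and Z :: "real set"
  assumes "finite Z" "Z \<noteq> {}"
    and below: "\<And>x. x \<le> Min Z \<Longrightarrow> sgn (f x) = sgn (g x)"
    and gap: "\<And>l u. l \<in> Z \<Longrightarrow> u \<in> Z \<Longrightarrow> l < u \<Longrightarrow> {l<..<u} \<inter> Z = {} \<Longrightarrow>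
      \<exists>\<theta>. strict_mono \<theta> \<and> surj \<theta> \<and> (\<forall>x. x \<le> l \<or> u \<le> x \<longrightarrow> \<theta> x = x) \<and>
        (\<forall>x\<in>{l..u}. sgn (f x) = sgn (g (\<theta> x)))"
  shows "\<exists>\<theta>. strict_mono \<theta> \<and> surj \<theta> \<and> (\<forall>x\<ge>Max Z. \<theta> x = x) \<and> (\<forall>z\<in>Z. \<theta> z = z) \<and>
    (\<forall>x\<le>Max Z. sgn (f x) = sgn (g (\<theta> x)))"
  using assms
proof (induction Z rule: finite_linorder_max_induct)
  case empty
  then show ?case by simp
next
  case (insert m Z)
  show ?case
  proof (cases "Z = {}")
    case True
    have "strict_mono (\<lambda>x::real. x)" by (simp add: strict_mono_def)
    then show ?thesis using insert.prems True by (intro exI[of _ "\<lambda>x. x"]) auto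
  next
    case False
    let ?l = "Max Z"
    have l: "?l \<in> Z" "?l < m" using False insert.hyps by auto
    have Min: "Min (insert m Z) = Min Z"
    proof (rule Min_eqI)
      show "Min Z \<le> y" if "y \<in> insert m Z" for y
        using that insert.hyps l by (cases "y = m") (meson Min_le less_imp_le order_trans, simp)
    qed (use insert.hyps False in auto)
    have Max: "Max (insert m Z) = m"
      using insert.hyps by (intro Max_eqI) (auto simp: order_le_less)
    have "\<exists>\<theta>. strict_mono \<theta> \<and> surj \<theta> \<and> (\<forall>x\<ge>Max Z. \<theta> x = x) \<and> (\<forall>z\<in>Z. \<theta> z = z) \<and>
      (\<forall>x\<le>Max Z. sgn (f x) = sgn (g (\<theta> x)))"
    proof (rule insert.IH[OF False])
      fix x assume "x \<le> Min Z" then show "sgn (f x) = sgn (g x)" using insert.prems(2) Min by simp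
    next
      fix l u assume lu: "l \<in> Z" "u \<in> Z" "l < u" "{l<..<u} \<inter> Z = {}"
      have "u < m" using lu insert.hyps by auto
      then have "{l<..<u} \<inter> insert m Z = {}" using lu by auto
      then show "\<exists>\<theta>. strict_mono \<theta> \<and> surj \<theta> \<and> (\<forall>x. x \<le> l \<or> u \<le> x \<longrightarrow> \<theta> x = x) \<and>
        (\<forall>x\<in>{l..u}. sgn (f x) = sgn (g (\<theta> x)))"
        using lu by (intro insert.prems(3)) auto
    qed
    then obtain \<theta> where \<theta>: "strict_mono \<theta>" "surj \<theta>" "\<forall>x\<ge>Max Z. \<theta> x = x" "\<forall>z\<in>Z. \<theta> z = z"
      "\<forall>x\<le>Max Z. sgn (f x) = sgn (g (\<theta> x))" by blast
    have "\<And>z. z \<in> Z \<Longrightarrow> z \<le> ?l" using insert.hyps by simp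
    then have "{?l<..<m} \<inter> insert m Z = {}" by force
    then have "\<exists>\<theta>. strict_mono \<theta> \<and> surj \<theta> \<and> (\<forall>x. x \<le> ?l \<or> m \<le> x \<longrightarrow> \<theta> x = x) \<and>
        (\<forall>x\<in>{?l..m}. sgn (f x) = sgn (g (\<theta> x)))"
      using l by (intro insert.prems(3)) auto
    then obtain \<eta> where \<eta>: "strict_mono \<eta>" "surj \<eta>" "\<And>x. x \<le> ?l \<or> m \<le> x \<Longrightarrow> \<eta> x = x"
      "\<And>x. x\<in>{?l..m} \<Longrightarrow> sgn (f x) = sgn (g (\<eta> x))" by blast
    have "sgn (f x) = sgn (g (\<theta> (\<eta> x)))" if "x \<le> m" for x
    proof (cases "x \<le> ?l")
      case True
      then show ?thesis using \<eta>(3)[of x] \<theta>(5) by simp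
    next
      case False
      then have "\<eta> x \<ge> ?l" using \<eta>(3)[of ?l] strict_mono_less_eq[OF \<eta>(1), of ?l x] by auto
      then show ?thesis using \<theta>(3) \<eta>(4)[of x] False that by simp
    qed
    moreover have "\<theta> (\<eta> z) = z" if "z \<in> insert m Z" for z
      using that \<theta>(3,4) \<eta>(3) l \<open>\<And>z. z \<in> Z \<Longrightarrow> z \<le> ?l\<close> by auto
    moreover have "\<theta> (\<eta> x) = x" if "x \<ge> m" for x
      using that \<theta>(3) \<eta>(3) l by auto
    moreover have "strict_mono (\<lambda>x. \<theta> (\<eta> x))" "surj (\<lambda>x. \<theta> (\<eta> x))"
      using \<theta>(1,2) \<eta>(1,2) comp_surj[of \<eta> \<theta>] by (auto simp: strict_mono_def comp_def)
    ultimately show ?thesis unfolding Max by (intro exI[of _ "\<lambda>x. \<theta> (\<eta> x)"]) simp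
  qed
qed

section \<open>Signs of univariate polynomials and extension of a sign-matching
  homeomorphism\<close>

lemma sgn_poly_same_position:
  fixes p :: "real poly"
  assumes "p \<noteq> 0" "\<And>z. poly p z = 0 \<Longrightarrow> sgn (x - z) = sgn (y - z)"
  shows "sgn (poly p x) = sgn (poly p y)"
proof -
  have *: "sgn (poly p x) = sgn (poly p y)" 
    if "x < y" and *: "\<And>z. poly p z = 0 \<Longrightarrow> sgn (x - z) = sgn (y - z)" for x y
  proof (rule ccontr)
    assume ne: "sgn (poly p x) \<noteq> sgn (poly p y)"
    have "poly p x \<noteq> 0" "poly p y \<noteq> 0" using *[of x] *[of y] \<open>x < y\<close> by (auto simp: sgn_if)
    then have "poly p x * poly p y < 0"
      using ne by (auto simp: sgn_if mult_less_0_iff split: if_splits)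
    then obtain z where "z > x" "z < y" "poly p z = 0" using poly_IVT \<open>x < y\<close> by blast
    then show False using *[of z] by (auto simp: sgn_if)
  qed
  consider "x < y" | "x = y" | "y < x" by linarith
  then show ?thesis
  proof cases
    case 1
    then show ?thesis using assms(2) by (rule *)
  next
    case 3
    have "sgn (poly p y) = sgn (poly p x)" using 3 assms(2)[symmetric] by (rule *)
    then show ?thesis ..
  qed auto
qed

lemma sgn_poly_at_top:
  fixes p :: "real poly"
  shows "\<exists>M. \<forall>x\<ge>M. sgn (poly p x) = sgn (lead_coeff p)"
proof -
  consider "p = 0" | "lead_coeff p > 0" | "lead_coeff p < 0"
    by (metis leading_coeff_0_iff linorder_less_linear)
  then show ?thesis
  proof cases
    case 2
    then obtain M where "\<forall>x\<ge>M. poly p x \<ge> lead_coeff p" using poly_pinfty_gt_lc by blast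
    then have "\<forall>x\<ge>M. poly p x > 0" using 2 by force
    then show ?thesis using 2 by (intro exI[of _ M]) simp
  next
    case 3
    then have "lead_coeff (- p) > 0" by simp
    then obtain M where "\<forall>x\<ge>M. poly (-p) x \<ge> lead_coeff (-p)" using poly_pinfty_gt_lc by blast
    then have "\<forall>x\<ge>M. poly p x < 0" using 3 by force
    then show ?thesis using 3 by (intro exI[of _ M]) simp
  qed auto
qed

lemma sgn_poly_at_bot:
  fixes p :: "real poly"
  shows "\<exists>M. \<forall>x\<le>M. sgn (poly p x) = (-1) ^ degree p * sgn (lead_coeff p)"
proof -
  let ?q = "pcompose p [:0, -1:]"
  obtain M where M: "\<And>x. x \<ge> M \<Longrightarrow> sgn (poly ?q x) = sgn (lead_coeff ?q)" using sgn_poly_at_top by blast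
  have lc: "lead_coeff ?q = lead_coeff p * (-1) ^ degree p"
    by (subst lead_coeff_comp) auto
  have "sgn (poly p x) = (-1) ^ degree p * sgn (lead_coeff p)" if "x \<le> - M" for x
    using M[of "- x"] that unfolding lc by (simp add: poly_pcompose sgn_mult power_sgn)
  then show ?thesis by blast
qed

text \<open>\<open>\<phi>\<close> is corrected to \<open>\<phi> \<circ> \<theta>\<close> with
  \<open>\<theta>\<close> fixing the roots of all nonzero \<open>A i\<close>, which keeps the old
  signs. By \<open>zeros\<close> the new pair already agrees at these roots. Between them the
  derivative has no root, so \<open>p\<close> and \<open>q \<circ> \<phi>\<close> are both strictly
  monotone in the same direction and their zeros can be aligned. Far out, degree and leading sign
  decide.\<close>

lemma extend_sign_homeo:
  fixes p q :: "real poly" and A B :: "'i \<Rightarrow> real poly" and \<phi> :: "real \<Rightarrow> real"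
  assumes fin: "finite S"
    and \<phi>: "strict_mono \<phi>" "surj \<phi>"
    and match: "\<And>i x. i \<in> S \<Longrightarrow> sgn (poly (A i) x) = sgn (poly (B i) (\<phi> x))"
    and deg: "degree p = degree q" "degree p > 0"
    and lc: "sgn (lead_coeff p) = sgn (lead_coeff q)"
    and deriv: "k \<in> S" "A k = pderiv p" "B k = pderiv q"
    and zeros: "\<And>i x. i \<in> S \<Longrightarrow> A i \<noteq> 0 \<Longrightarrow> poly (A i) x = 0 \<Longrightarrow> sgn (poly p x) = sgn (poly q (\<phi> x))"
  shows "\<exists>\<psi>. strict_mono \<psi> \<and> surj \<psi> \<and> (\<forall>i\<in>S. \<forall>x. sgn (poly (A i) x) = sgn (poly (B i) (\<psi> x))) \<and>
    (\<forall>x. sgn (poly p x) = sgn (poly q (\<psi> x)))"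
proof -
  define Z0 where "Z0 = (\<Union>i\<in>{i\<in>S. A i \<noteq> 0}. {x. poly (A i) x = 0})"
  have finZ0: "finite Z0" unfolding Z0_def using fin by (auto intro: poly_roots_finite)
  define f where "f = poly p"
  define g where "g = (\<lambda>x. poly q (\<phi> x))"
  have contf: "continuous_on T f" for T unfolding f_def by (intro continuous_intros)
  have contg: "continuous_on T g" for T unfolding g_def
    using continuous_on_subset[OF strict_mono_surj_isCont[OF \<phi>]] by (intro continuous_intros) auto
  obtain M1 M2 where M: "\<And>x. x \<ge> M1 \<Longrightarrow> sgn (poly p x) = sgn (lead_coeff p)"
    "\<And>x. x \<ge> M2 \<Longrightarrow> sgn (poly q x) = sgn (lead_coeff q)"
    using sgn_poly_at_top by metis
  obtain M3 where M3: "\<phi> M3 = M2" using \<phi>(2) by (metis surjD)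
  obtain N1 N2 where N: "\<And>x. x \<le> N1 \<Longrightarrow> sgn (poly p x) = (-1) ^ degree p * sgn (lead_coeff p)"
    "\<And>x. x \<le> N2 \<Longrightarrow> sgn (poly q x) = (-1) ^ degree q * sgn (lead_coeff q)"
    using sgn_poly_at_bot by metis
  obtain N3 where N3: "\<phi> N3 = N2" using \<phi>(2) by (metis surjD)
  \<comment> \<open>\<open>U\<close> lies beyond all old roots and beyond the places where
    \<open>p\<close> and, through \<open>\<phi>\<close>, \<open>q\<close> have taken their final
    signs. The \<open>0\<close> put into both sets ensures \<open>L \<le> U\<close>, which the other
    entries alone would not.\<close>
  define U where "U = Max (insert M1 (insert M3 (insert 0 Z0)))"
  define L where "L = Min (insert N1 (insert N3 (insert 0 Z0)))"
  have U: "M1 \<le> U" "M3 \<le> U" "0 \<le> U" "\<And>z. z \<in> Z0 \<Longrightarrow> z \<le> U"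
    unfolding U_def using finZ0 by (simp_all only: Max_ge finite_insert insertI1 insertI2)
  have L: "L \<le> N1" "L \<le> N3" "L \<le> 0" "\<And>z. z \<in> Z0 \<Longrightarrow> L \<le> z"
    unfolding L_def using finZ0 by (simp_all only: Min_le finite_insert insertI1 insertI2)
  have up: "sgn (f x) = sgn (g x)" if "x \<ge> U" for x
  proof -
    have "\<phi> x \<ge> M2" using that U(2) M3 strict_mono_less_eq[OF \<phi>(1), of M3 x] by simp
    then show ?thesis using M(1)[of x] M(2)[of "\<phi> x"] that U(1) lc by (simp add: f_def g_def)
  qed
  have down: "sgn (f x) = sgn (g x)" if "x \<le> L" for x
  proof -
    have "\<phi> x \<le> N2" using that L(2) N3 strict_mono_less_eq[OF \<phi>(1), of x N3] by simp
    then show ?thesis using N(1)[of x] N(2)[of "\<phi> x"] that L(1) lc deg(1) by (simp add: f_def g_def)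
  qed
  define Z where "Z = insert L (insert U Z0)"
  have finZ: "finite Z" "Z \<noteq> {}" using finZ0 by (auto simp: Z_def)
  have MaxZ: "Max Z = U" using U L finZ by (intro Max_eqI) (auto simp: Z_def)
  have MinZ: "Min Z = L" using U L finZ by (intro Min_eqI) (auto simp: Z_def)
  have onZ: "sgn (f z) = sgn (g z)" if "z \<in> Z" for z
    using that up[of U] down[of L] zeros by (auto simp: Z_def Z0_def f_def g_def)
  have root_in_Z: "z \<in> Z" if "i \<in> S" "A i \<noteq> 0" "poly (A i) z = 0" for i z
    using that by (auto simp: Z_def Z0_def)
  have pd: "pderiv p \<noteq> 0" using deg(2) by (simp add: pderiv_eq_0_iff)
  have "\<exists>\<theta>. strict_mono \<theta> \<and> surj \<theta> \<and> (\<forall>x\<ge>Max Z. \<theta> x = x) \<and> (\<forall>z\<in>Z. \<theta> z = z) \<and>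
    (\<forall>x\<le>Max Z. sgn (f x) = sgn (g (\<theta> x)))"
  proof (rule glue_sign_match[OF finZ])
    fix x assume "x \<le> Min Z" then show "sgn (f x) = sgn (g x)" using down MinZ by simp
  next
    fix l u assume lu: "l \<in> Z" "u \<in> Z" "l < u" "{l<..<u} \<inter> Z = {}"
    have const: "sgn (poly (pderiv p) x) = sgn (poly (pderiv p) ((l + u) / 2))" if x: "x \<in> {l<..<u}" for x
    proof (rule sgn_poly_same_position[OF pd])
      fix z assume "poly (pderiv p) z = 0"
      then have "z \<in> Z" using root_in_Z[OF deriv(1)] deriv(2) pd by metis
      then have "z \<le> l \<or> u \<le> z" using lu(4) by force
      then show "sgn (x - z) = sgn ((l + u) / 2 - z)"
        using x by (auto simp: field_simps)
    qed
    have nz: "poly (pderiv p) ((l + u) / 2) \<noteq> 0"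
    proof
      assume "poly (pderiv p) ((l + u) / 2) = 0"
      then have "(l + u) / 2 \<in> Z" using root_in_Z[OF deriv(1)] deriv(2) pd by metis
      moreover have "(l + u) / 2 \<in> {l<..<u}" using lu(3) by simp
      ultimately show False using lu(4) by blast
    qed
    have matchd: "sgn (poly (pderiv p) x) = sgn (poly (pderiv q) (\<phi> x))" for x
      using match[OF deriv(1)] deriv by simp
    \<comment> \<open>\<open>\<phi>\<close> need not be differentiable, so \<open>g\<close> has no
      derivative to look at. Its monotonicity comes from that of \<open>q\<close> on the image
      interval, whose inner points are images of points between \<open>x\<close> and
      \<open>y\<close>.\<close>
    have pre: "\<exists>v. w = \<phi> v \<and> v \<in> {x<..<y}" if "\<phi> x < w" "w < \<phi> y" for w x y
      using that \<phi> by (metis greaterThanLessThan_iff strict_mono_less surjD)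
    have "strict_mono_on {l..u} f \<and> strict_mono_on {l..u} g \<or>
      strict_antimono_on {l..u} f \<and> strict_antimono_on {l..u} g"
    proof (cases "poly (pderiv p) ((l + u) / 2) > 0")
      case True
      then have pos: "poly (pderiv p) x > 0" if "x \<in> {l<..<u}" for x
        using const[OF that] by (metis sgn_greater sgn_pos zero_less_one)
      then have posq: "poly (pderiv q) (\<phi> x) > 0" if "x \<in> {l<..<u}" for x
        using matchd[of x] that by (metis sgn_greater)
      have "f x < f y" if "x \<in> {l..u}" "y \<in> {l..u}" "x < y" for x y
      proof (rule DERIV_pos_imp_increasing_open[OF that(3)])
        show "\<exists>d. (f has_real_derivative d) (at v) \<and> 0 < d" if "x < v" "v < y" for v
          using pos[of v] that \<open>x \<in> {l..u}\<close> \<open>y \<in> {l..u}\<close>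
          by (intro exI[of _ "poly (pderiv p) v"]) (simp add: f_def)
      qed (rule contf)
      moreover have "g x < g y" if "x \<in> {l..u}" "y \<in> {l..u}" "x < y" for x y
        unfolding g_def
      proof (rule DERIV_pos_imp_increasing_open[where f = "poly q" and a = "\<phi> x" and b = "\<phi> y"])
        show "\<phi> x < \<phi> y" using \<phi>(1) that(3) by (rule strict_monoD)
        show "\<exists>d. (poly q has_real_derivative d) (at w) \<and> 0 < d" if w: "\<phi> x < w" "w < \<phi> y" for w
        proof -
          obtain v where "w = \<phi> v" "v \<in> {x<..<y}" using pre[OF w] by blast
          then show ?thesis
            using posq[of v] \<open>x \<in> {l..u}\<close> \<open>y \<in> {l..u}\<close>
            by (intro exI[of _ "poly (pderiv q) w"]) simp
        qed
        show "continuous_on {\<phi> x..\<phi> y} (poly q)" by (intro continuous_intros)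
      qed
      ultimately show ?thesis by (auto simp: monotone_on_def)
    next
      case False
      with nz have "poly (pderiv p) ((l + u) / 2) < 0" by linarith
      then have neg: "poly (pderiv p) x < 0" if "x \<in> {l<..<u}" for x
        using const[OF that] by (metis sgn_less sgn_neg neg_less_0_iff_less zero_less_one)
      then have negq: "poly (pderiv q) (\<phi> x) < 0" if "x \<in> {l<..<u}" for x
        using matchd[of x] that by (metis sgn_less)
      have "f x > f y" if "x \<in> {l..u}" "y \<in> {l..u}" "x < y" for x y
      proof (rule DERIV_neg_imp_decreasing_open[OF that(3)])
        show "\<exists>d. (f has_real_derivative d) (at v) \<and> d < 0" if "x < v" "v < y" for v
          using neg[of v] that \<open>x \<in> {l..u}\<close> \<open>y \<in> {l..u}\<close>
          by (intro exI[of _ "poly (pderiv p) v"]) (simp add: f_def)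
      qed (rule contf)
      moreover have "g x > g y" if "x \<in> {l..u}" "y \<in> {l..u}" "x < y" for x y
        unfolding g_def
      proof (rule DERIV_neg_imp_decreasing_open[where f = "poly q" and a = "\<phi> x" and b = "\<phi> y"])
        show "\<phi> x < \<phi> y" using \<phi>(1) that(3) by (rule strict_monoD)
        show "\<exists>d. (poly q has_real_derivative d) (at w) \<and> d < 0" if w: "\<phi> x < w" "w < \<phi> y" for w
        proof -
          obtain v where "w = \<phi> v" "v \<in> {x<..<y}" using pre[OF w] by blast
          then show ?thesis
            using negq[of v] \<open>x \<in> {l..u}\<close> \<open>y \<in> {l..u}\<close>
            by (intro exI[of _ "poly (pderiv q) w"]) simp
        qed
        show "continuous_on {\<phi> x..\<phi> y} (poly q)" by (intro continuous_intros)
      qed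
      ultimately show ?thesis by (auto simp: monotone_on_def)
    qed
    then show "\<exists>\<theta>. strict_mono \<theta> \<and> surj \<theta> \<and> (\<forall>x. x \<le> l \<or> u \<le> x \<longrightarrow> \<theta> x = x) \<and>
        (\<forall>x\<in>{l..u}. sgn (f x) = sgn (g (\<theta> x)))"
      by (intro monotone_sign_match lu contf contg onZ)
  qed
  then obtain \<theta> where \<theta>: "strict_mono \<theta>" "surj \<theta>" "\<forall>x\<ge>U. \<theta> x = x" "\<forall>z\<in>Z. \<theta> z = z"
    "\<forall>x\<le>U. sgn (f x) = sgn (g (\<theta> x))" unfolding MaxZ by blast
  have pos: "sgn (x - z) = sgn (\<theta> x - z)" if "z \<in> Z" for x z
    using \<theta>(1,4) that strict_mono_less[OF \<theta>(1), of x z] strict_mono_less[OF \<theta>(1), of z x]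
    by (auto simp: sgn_if)
  have "sgn (poly (A i) x) = sgn (poly (B i) (\<phi> (\<theta> x)))" if i: "i \<in> S" for i x
  proof -
    have "sgn (poly (A i) x) = sgn (poly (A i) (\<theta> x))"
    proof (cases "A i = 0")
      case False
      then show ?thesis by (rule sgn_poly_same_position) (use pos root_in_Z[OF i False] in blast)
    qed simp
    then show ?thesis using match[OF i] by simp
  qed
  moreover have "sgn (poly p x) = sgn (poly q (\<phi> (\<theta> x)))" for x
    using \<theta>(3,5) up[of x] by (cases "x \<le> U") (auto simp: f_def g_def)
  moreover have "strict_mono (\<lambda>x. \<phi> (\<theta> x))" "surj (\<lambda>x. \<phi> (\<theta> x))"
    using \<phi> \<theta>(1,2) comp_surj[of \<theta> \<phi>] by (auto simp: strict_mono_def comp_def)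
  ultimately show ?thesis by (intro exI[of _ "\<lambda>x. \<phi> (\<theta> x)"]) simp
qed

section \<open>Sign diagrams of polynomials with parameters\<close>

definition param_poly :: "('a::real_normed_vector \<Rightarrow> real poly) \<Rightarrow> nat \<Rightarrow> bool" where
  "param_poly P d \<longleftrightarrow> (\<forall>a. degree (P a) \<le> d) \<and> (\<forall>j. real_polynomial_function (\<lambda>a. coeff (P a) j))"

lemma param_poly_degree: "param_poly P d \<Longrightarrow> degree (P a) \<le> d"
  by (simp add: param_poly_def)

lemma param_poly_coeff: "param_poly P d \<Longrightarrow> real_polynomial_function (\<lambda>a. coeff (P a) j)"
  by (simp add: param_poly_def)

lemma param_poly_pderiv: "param_poly P (Suc d) \<Longrightarrow> param_poly (\<lambda>a. pderiv (P a)) d"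
  unfolding param_poly_def
  by (auto simp: degree_pderiv coeff_pderiv le_diff_conv intro!: real_polynomial_function.intros(2,4))

text \<open>Where the coefficient at the formal degree \<open>d\<close> vanishes, the truncation is
  the polynomial itself, now with a smaller formal degree. This is how parameters with a vanishing
  leading coefficient are treated.\<close>

definition truncate_poly :: "nat \<Rightarrow> real poly \<Rightarrow> real poly" where
  "truncate_poly d p = p - monom (coeff p d) d"

lemma param_poly_truncate:
  assumes "param_poly P (Suc d)" shows "param_poly (\<lambda>a. truncate_poly (Suc d) (P a)) d"
  unfolding param_poly_def truncate_poly_def
proof (intro conjI allI degree_le impI)
  fix a i assume "d < i"
  then show "coeff (P a - monom (coeff (P a) (Suc d)) (Suc d)) i = 0"
    using param_poly_degree[OF assms, of a] by (cases "i = Suc d") (auto intro: coeff_eq_0)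
next
  fix j
  show "real_polynomial_function (\<lambda>a. coeff (P a - monom (coeff (P a) (Suc d)) (Suc d)) j)"
    using param_poly_coeff[OF assms] by (cases "j = Suc d") (auto intro: real_polynomial_function.intros(2))
qed

lemma param_poly_lead: "param_poly P d \<Longrightarrow> param_poly (\<lambda>a. [:coeff (P a) d:]) 0"
  unfolding param_poly_def
proof (intro conjI allI)
  fix j assume *: "(\<forall>a. degree (P a) \<le> d) \<and> (\<forall>j. real_polynomial_function (\<lambda>a. coeff (P a) j))"
  show "real_polynomial_function (\<lambda>a. coeff [:coeff (P a) d:] j)"
    using * by (cases j) (auto intro: real_polynomial_function.intros(2))
qed simp

lemma param_poly_mono: "param_poly P d \<Longrightarrow> d \<le> e \<Longrightarrow> param_poly P e"
  unfolding param_poly_def using le_trans by blast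

text \<open>Multiplying by the square of the leading coefficient of \<open>Q\<close> keeps the sign of \<open>P\<close>.\<close>

lemma param_poly_remainder:
  assumes "param_poly P m" and Q: "param_poly Q (Suc n)"
  shows "\<exists>R. param_poly R n \<and> (\<forall>a x. coeff (Q a) (Suc n) \<noteq> 0 \<longrightarrow> poly (Q a) x = 0 \<longrightarrow>
    sgn (poly (P a) x) = sgn (poly (R a) x))"
  using assms(1)
proof (induction m arbitrary: P)
  case 0
  then show ?case using param_poly_mono[of P 0 n] by blast
next
  case (Suc m)
  show ?case
  proof (cases "m < n")
    case True
    then show ?thesis using param_poly_mono[OF Suc.prems, of n] by auto
  next
    case False
    define c where "c = (\<lambda>a. coeff (Q a) (Suc n))"
    define b where "b = (\<lambda>a. coeff (P a) (Suc m))"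
    define k where "k = m - n"
    \<comment> \<open>One division step without inverting \<open>c a\<close>: \<open>k\<close>
      shifts \<open>Q a\<close> to formal degree \<open>Suc m\<close>, where both terms have the
      coefficient \<open>c a * c a * b a\<close> and cancel.\<close>
    define P' where "P' = (\<lambda>a. smult (c a * c a) (P a) - smult (c a * b a) (monom 1 k * Q a))"
    have coeff: "coeff (P' a) j = c a * c a * coeff (P a) j - c a * b a * (if j < k then 0 else coeff (Q a) (j - k))" for a j
      by (simp add: P'_def coeff_monom_mult)
    have "param_poly P' m"
      unfolding param_poly_def
    proof (intro conjI allI degree_le impI)
      fix a i assume "m < i"
      show "coeff (P' a) i = 0"
      proof (cases "i = Suc m")
        case True
        then have "i - k = Suc n" "\<not> i < k" using False by (auto simp: k_def)
        then show ?thesis by (simp add: coeff True b_def c_def)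
      next
        case False
        then have "i > Suc m" "i - k > Suc n" using \<open>m < i\<close> \<open>\<not> m < n\<close> by (auto simp: k_def)
        then show ?thesis
          using param_poly_degree[OF Q, of a] param_poly_degree[OF Suc.prems, of a] 
          by (simp add: coeff coeff_eq_0)
      qed
    next
      fix j
      have "real_polynomial_function (\<lambda>a. if j < k then 0 else coeff (Q a) (j - k))"
        using param_poly_coeff[OF Q] real_polynomial_function.intros(2) by (cases "j < k") simp_all
      then show "real_polynomial_function (\<lambda>a. coeff (P' a) j)"
        unfolding coeff b_def c_def
        by (intro real_polynomial_function_diff real_polynomial_function.intros(4) param_poly_coeff[OF Q] param_poly_coeff[OF Suc.prems])
    qed
    then obtain R where R: "param_poly R n" "\<And>a x. coeff (Q a) (Suc n) \<noteq> 0 \<Longrightarrow> poly (Q a) x = 0 \<Longrightarrow>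
        sgn (poly (P' a) x) = sgn (poly (R a) x)" using Suc.IH by blast
    have "sgn (poly (P a) x) = sgn (poly (P' a) x)" if "coeff (Q a) (Suc n) \<noteq> 0" "poly (Q a) x = 0" for a x
    proof -
      have "c a * c a > 0" using that(1) by (simp add: c_def zero_less_mult_iff) linarith
      then have "sgn (c a * c a * poly (P a) x) = sgn (poly (P a) x)"
        by (simp only: sgn_mult[of "c a * c a"] sgn_pos mult_1)
      then show ?thesis using that(2) by (simp add: P'_def)
    qed
    then show ?thesis using R by (intro exI[of _ R]) auto
  qed
qed

definition sign_remainder ::
    "('a \<Rightarrow> real poly) \<Rightarrow> ('a \<Rightarrow> real poly) \<Rightarrow> nat \<Rightarrow> ('a \<Rightarrow> real poly) \<Rightarrow> bool" where
  "sign_remainder P Q n R \<longleftrightarrow> (\<forall>a x. coeff (Q a) n \<noteq> 0 \<longrightarrow> poly (Q a) x = 0 \<longrightarrow>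
    sgn (poly (P a) x) = sgn (poly (R a) x))"

text \<open>Each family member carries a formal degree, since the actual degree varies with the parameter.\<close>

definition closed_from :: "nat \<Rightarrow> (('a::real_normed_vector \<Rightarrow> real poly) \<times> nat) set \<Rightarrow> bool" where
  "closed_from e F \<longleftrightarrow>
    (\<forall>P d. (P, d) \<in> F \<longrightarrow> param_poly P d) \<and>
    (\<forall>P d. (P, Suc d) \<in> F \<longrightarrow> e \<le> d \<longrightarrow> (\<lambda>a. pderiv (P a), d) \<in> F \<and>
      (\<lambda>a. truncate_poly (Suc d) (P a), d) \<in> F \<and> (\<lambda>a. [:coeff (P a) (Suc d):], 0) \<in> F) \<and>
    (\<forall>P m Q n. (P, m) \<in> F \<longrightarrow> (Q, Suc n) \<in> F \<longrightarrow> e \<le> n \<longrightarrow> Suc n \<le> m \<longrightarrow>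
      (\<exists>R. (R, n) \<in> F \<and> sign_remainder P Q (Suc n) R))"

lemma closed_fromD:
  assumes "closed_from e F"
  shows "(P, d) \<in> F \<Longrightarrow> param_poly P d"
    "(P, Suc d) \<in> F \<Longrightarrow> e \<le> d \<Longrightarrow> (\<lambda>a. pderiv (P a), d) \<in> F"
    "(P, Suc d) \<in> F \<Longrightarrow> e \<le> d \<Longrightarrow> (\<lambda>a. truncate_poly (Suc d) (P a), d) \<in> F"
    "(P, Suc d) \<in> F \<Longrightarrow> e \<le> d \<Longrightarrow> (\<lambda>a. [:coeff (P a) (Suc d):], 0) \<in> F"
    "(P, m) \<in> F \<Longrightarrow> (Q, Suc n) \<in> F \<Longrightarrow> e \<le> n \<Longrightarrow> Suc n \<le> m \<Longrightarrow>
      \<exists>R. (R, n) \<in> F \<and> sign_remainder P Q (Suc n) R"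
proof -
  note 1 = assms[unfolded closed_from_def, THEN conjunct1]
  note 2 = assms[unfolded closed_from_def, THEN conjunct2, THEN conjunct1]
  note 3 = assms[unfolded closed_from_def, THEN conjunct2, THEN conjunct2]
  show "(P, d) \<in> F \<Longrightarrow> param_poly P d" using 1 by blast
  show "(P, Suc d) \<in> F \<Longrightarrow> e \<le> d \<Longrightarrow> (\<lambda>a. pderiv (P a), d) \<in> F"
    "(P, Suc d) \<in> F \<Longrightarrow> e \<le> d \<Longrightarrow> (\<lambda>a. truncate_poly (Suc d) (P a), d) \<in> F"
    "(P, Suc d) \<in> F \<Longrightarrow> e \<le> d \<Longrightarrow> (\<lambda>a. [:coeff (P a) (Suc d):], 0) \<in> F"
    using 2 by blast+
  show "(P, m) \<in> F \<Longrightarrow> (Q, Suc n) \<in> F \<Longrightarrow> e \<le> n \<Longrightarrow> Suc n \<le> m \<Longrightarrow>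
      \<exists>R. (R, n) \<in> F \<and> sign_remainder P Q (Suc n) R"
    using 3 by blast
qed

text \<open>\<open>closed_from e\<close> makes demands only on members of formal degree above
  \<open>e\<close>. All that has to be added when \<open>e\<close> is lowered by one has formal
  degree at most the new \<open>e\<close>, so it raises no further demands at that level: one finite
  round suffices.\<close>

lemma closed_from_step:
  assumes F: "finite F" "closed_from (Suc e) F"
  shows "\<exists>F'. F \<subseteq> F' \<and> finite F' \<and> closed_from e F'"
proof -
  \<comment> \<open>A fixed choice of remainder makes \<open>N4\<close> the image of a finite
    set.\<close>
  define rem :: "('a \<Rightarrow> real poly) \<Rightarrow> ('a \<Rightarrow> real poly) \<Rightarrow> nat \<Rightarrow> 'a \<Rightarrow> real poly" where
    "rem = (\<lambda>P Q n. SOME R. param_poly R n \<and> sign_remainder P Q (Suc n) R)"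
  have rem: "param_poly (rem P Q n) n \<and> sign_remainder P Q (Suc n) (rem P Q n)"
    if "param_poly P m" "param_poly Q (Suc n)" for P m Q n
    using param_poly_remainder[OF that] unfolding rem_def sign_remainder_def by (rule someI_ex)
  define N1 where "N1 = (\<lambda>(P, d). (\<lambda>a. pderiv (P a) :: real poly, e)) ` {p \<in> F. snd p = Suc e}"
  define N2 where "N2 = (\<lambda>(P, d). (\<lambda>a. truncate_poly (Suc e) (P a), e)) ` {p \<in> F. snd p = Suc e}"
  define N3 where "N3 = (\<lambda>(P, d). (\<lambda>a. [:coeff (P a) (Suc e) :: real:], 0 :: nat)) ` {p \<in> F. snd p = Suc e}"
  define N4 where "N4 = (\<lambda>((P, m), (Q, d)). (rem P Q e, e)) ` (F \<times> {p \<in> F. snd p = Suc e})"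
  let ?F = "F \<union> N1 \<union> N2 \<union> N3 \<union> N4"
  have valid: "param_poly P d" if "(P, d) \<in> F" for P d
    using closed_fromD(1)[OF F(2) that] .
  have new: "param_poly P d \<and> d \<le> e" if "(P, d) \<in> N1 \<union> N2 \<union> N3 \<union> N4" for P d
    using that valid unfolding N1_def N2_def N3_def N4_def
    by (auto intro: param_poly_pderiv param_poly_truncate param_poly_lead)
      (use rem valid in blast)
  have old: "(P, Suc d) \<in> F" if "(P, Suc d) \<in> ?F" "e \<le> d" for P d
    using that new[of P "Suc d"] by auto
  have "closed_from e ?F"
    unfolding closed_from_def
  proof (intro conjI allI impI)
    fix P d assume "(P, d) \<in> ?F" then show "param_poly P d" using valid new by auto
  next
    fix P d assume *: "(P, Suc d) \<in> ?F" "e \<le> d"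
    note PF = old[OF this]
    have "(\<lambda>a. pderiv (P a), d) \<in> ?F \<and> (\<lambda>a. truncate_poly (Suc d) (P a), d) \<in> ?F \<and>
      (\<lambda>a. [:coeff (P a) (Suc d):], 0) \<in> ?F"
    proof (cases "d = e")
      case True
      then have "(P, Suc e) \<in> {p \<in> F. snd p = Suc e}" using PF by simp
      then have "(\<lambda>a. pderiv (P a), e) \<in> N1" "(\<lambda>a. truncate_poly (Suc e) (P a), e) \<in> N2"
        "(\<lambda>a. [:coeff (P a) (Suc e):], 0) \<in> N3"
        unfolding N1_def N2_def N3_def by (auto intro: rev_image_eqI)
      then show ?thesis unfolding True by simp
    next
      case False
      then have "Suc e \<le> d" using *(2) by simp
      then show ?thesis using closed_fromD(2-4)[OF F(2) PF] by simp
    qed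
    then show "(\<lambda>a. pderiv (P a), d) \<in> ?F" "(\<lambda>a. truncate_poly (Suc d) (P a), d) \<in> ?F"
      "(\<lambda>a. [:coeff (P a) (Suc d):], 0) \<in> ?F" by simp_all
  next
    fix P m Q n assume *: "(P, m) \<in> ?F" "(Q, Suc n) \<in> ?F" "e \<le> n" "Suc n \<le> m"
    then obtain m' where m': "m = Suc m'" by (cases m) auto
    then have PF: "(P, m) \<in> F" using old[of P m'] * by auto
    have QF: "(Q, Suc n) \<in> F" using old * by auto
    show "\<exists>R. (R, n) \<in> ?F \<and> sign_remainder P Q (Suc n) R"
    proof (cases "n = e")
      case True
      then have "((P, m), (Q, Suc e)) \<in> F \<times> {p \<in> F. snd p = Suc e}" using PF QF by simp
      then have "(rem P Q e, e) \<in> N4" unfolding N4_def by (rule rev_image_eqI) simp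
      then show ?thesis using True rem[OF valid[OF PF] valid[OF QF]] by blast
    next
      case False
      then have "Suc e \<le> n" using *(3) by simp
      then show ?thesis using closed_fromD(5)[OF F(2) PF QF _ *(4)] by blast
    qed
  qed
  moreover have "finite ?F" unfolding N1_def N2_def N3_def N4_def using F(1) by simp
  ultimately show ?thesis by (intro exI[of _ ?F]) blast
qed

lemma closed_from_exists:
  assumes "finite F" "closed_from e F"
  shows "\<exists>F'. F \<subseteq> F' \<and> finite F' \<and> closed_from 0 F'"
  using assms
proof (induction e arbitrary: F)
  case (Suc e)
  from closed_from_step[OF Suc.prems] show ?case using Suc.IH by (meson subset_trans)
qed auto

lemma poly_degree_0: "degree p \<le> 0 \<Longrightarrow> poly p x = coeff p 0"
  using degree_eq_zeroE[of p] by force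

lemma truncate_poly_lead_zero: "coeff p d = 0 \<Longrightarrow> truncate_poly d p = p"
  by (simp add: truncate_poly_def)

text \<open>Cohen--Hoermander elimination, with the sign diagrams of two sections compared through an
  order isomorphism of the line instead of being tabulated.\<close>

theorem sign_homeo_exists:
  fixes G :: "('a::real_normed_vector \<Rightarrow> real poly) set"
  assumes G: "finite G" "\<And>P. P \<in> G \<Longrightarrow> \<exists>d. param_poly P d"
  shows "\<exists>Q. finite Q \<and> (\<forall>q\<in>Q. real_polynomial_function q) \<and>
    (\<forall>a b. (\<forall>q\<in>Q. sgn (q a) = sgn (q b)) \<longrightarrow>
      (\<exists>\<phi>. strict_mono \<phi> \<and> surj \<phi> \<and> (\<forall>P\<in>G. \<forall>x. sgn (poly (P a) x) = sgn (poly (P b) (\<phi> x)))))"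
proof -
  obtain dg where dg: "\<And>P. P \<in> G \<Longrightarrow> param_poly P (dg P)" using G(2) by metis
  let ?F0 = "(\<lambda>P. (P, dg P)) ` G"
  \<comment> \<open>The sum bounds every single degree, so at this level closure demands nothing and
    the descent can start.\<close>
  have "closed_from (\<Sum>P\<in>G. dg P) ?F0"
  proof -
    have le: "dg P \<le> (\<Sum>P\<in>G. dg P)" if "P \<in> G" for P
      using G(1) that by (simp add: member_le_sum)
    then have "\<not> (\<Sum>P\<in>G. dg P) \<le> d" if "(P, Suc d) \<in> ?F0" for P d
      using that le by (fastforce simp: not_le)
    then show ?thesis unfolding closed_from_def using dg by blast
  qed
  then obtain F where F: "?F0 \<subseteq> F" "finite F" "closed_from 0 F"
    using closed_from_exists[of ?F0] G(1) by blast
  have valid: "param_poly P d" if "(P, d) \<in> F" for P d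
    using closed_fromD(1)[OF F(3) that] .
  have op: "(\<lambda>a. pderiv (P a), d) \<in> F" "(\<lambda>a. truncate_poly (Suc d) (P a), d) \<in> F"
    "(\<lambda>a. [:coeff (P a) (Suc d):], 0) \<in> F" if "(P, Suc d) \<in> F" for P d
    using closed_fromD(2-4)[OF F(3) that] by simp_all
  have remd: "\<exists>R. (R, n) \<in> F \<and> sign_remainder P Q (Suc n) R"
    if "(P, m) \<in> F" "(Q, Suc n) \<in> F" "Suc n \<le> m" for P m Q n
    using closed_fromD(5)[OF F(3) that(1,2) _ that(3)] by simp
  \<comment> \<open>A member of formal degree 0 depends on the parameter alone. The leading
    coefficients of all other members are among these, so equal signs on \<open>Q\<close> mean that
    the same leading coefficients vanish and that the others have equal signs.\<close>
  define Q where "Q = (\<lambda>p a. coeff (fst p a) 0) ` {p \<in> F. snd p = 0}"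
  have "\<exists>\<phi>. strict_mono \<phi> \<and> surj \<phi> \<and> (\<forall>P\<in>G. \<forall>x. sgn (poly (P a) x) = sgn (poly (P b) (\<phi> x)))"
    if Qab: "\<forall>q\<in>Q. sgn (q a) = sgn (q b)" for a b
  proof -
    have const: "sgn (coeff (P a) 0) = sgn (coeff (P b) 0)" if "(P, 0) \<in> F" for P
      using Qab that unfolding Q_def by force
    have lead: "sgn (coeff (P a) (Suc d)) = sgn (coeff (P b) (Suc d))" if "(P, Suc d) \<in> F" for P d
      using const[OF op(3)[OF that]] by simp
    \<comment> \<open>Members enter in the order of their formal degree. The second premise says
      that \<open>S\<close> holds everything of lower degree, so derivative, truncation and
      remainders of a newcomer are already matched.\<close>
    have extend: "S \<subseteq> F \<Longrightarrow> (\<forall>r\<in>S. \<forall>q\<in>F. snd q < snd r \<longrightarrow> q \<in> S) \<Longrightarrow> 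
      \<exists>\<phi>. strict_mono \<phi> \<and> surj \<phi> \<and> (\<forall>p\<in>S. \<forall>x. sgn (poly (fst p a) x) = sgn (poly (fst p b) (\<phi> x)))"
      if "finite S" for S
      using that
    proof (induction S rule: finite_ranking_induct[where f = snd])
      case empty
      show ?case using strict_mono_id by (intro exI[of _ "\<lambda>x. x"]) (auto simp: strict_mono_def)
    next
      case (insert p S)
      obtain P m where p: "p = (P, m)" by fastforce
      have PF: "(P, m) \<in> F" using insert.prems p by simp
      show ?case
      proof (cases m)
        case 0
        \<comment> \<open>The newcomer has the largest formal degree, so here every member is
          constant in \<open>x\<close> and the identity serves.\<close>
        have "sgn (poly (fst r a) x) = sgn (poly (fst r b) x)" if r: "r \<in> insert p S" for r x
        proof -
          have r0: "(fst r, 0) \<in> F" using r insert.hyps(2)[of r] insert.prems(1) p 0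
            by (cases r) auto
          show ?thesis
            using const[OF r0] param_poly_degree[OF valid[OF r0]] by (simp add: poly_degree_0)
        qed
        then show ?thesis by (intro exI[of _ "\<lambda>x. x"]) (auto simp: strict_mono_def)
      next
        case (Suc d)
        have low: "q \<in> S" if "q \<in> F" "snd q < m" for q
          using insert.prems(2) that p by force
        have "\<forall>r\<in>S. \<forall>q\<in>F. snd q < snd r \<longrightarrow> q \<in> S"
          using insert.hyps(2) low p by (force dest: less_le_trans)
        then obtain \<phi> where \<phi>: "strict_mono \<phi>" "surj \<phi>"
          "\<And>r x. r \<in> S \<Longrightarrow> sgn (poly (fst r a) x) = sgn (poly (fst r b) (\<phi> x))"
          using insert.IH insert.prems(1) by (meson insert_subset)
        note opP = op[OF PF[unfolded Suc]]
        note leadP = lead[OF PF[unfolded Suc]]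
        show ?thesis
        proof (cases "coeff (P a) (Suc d) = 0")
          case True
          \<comment> \<open>The leading coefficient vanishes at both parameters or at neither. Here
            \<open>P\<close> equals its truncation at both, and \<open>\<phi>\<close> already
            matches that one.\<close>
          then have "coeff (P b) (Suc d) = 0" using leadP by (simp add: sgn_0_0)
          with True have "truncate_poly (Suc d) (P a) = P a" "truncate_poly (Suc d) (P b) = P b"
            by (simp_all add: truncate_poly_lead_zero)
          then have "sgn (poly (P a) x) = sgn (poly (P b) (\<phi> x))" for x
            using \<phi>(3)[OF low[OF opP(2)], of x] Suc by simp
          then show ?thesis using \<phi> p by (intro exI[of _ \<phi>]) auto
        next
          case False
          then have False': "coeff (P b) (Suc d) \<noteq> 0" using leadP by (metis sgn_0_0)
          have deg: "degree (P a) = Suc d" "degree (P b) = Suc d"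
            using False False' param_poly_degree[OF valid[OF PF[unfolded Suc]]]
            by (simp_all add: le_antisym le_degree)
          \<comment> \<open>At a root of \<open>Q a\<close> the sign of \<open>P a\<close> is that
            of the remainder, a member of lower degree matched by \<open>\<phi>\<close>; and
            \<open>\<phi> x\<close> is a root of \<open>Q b\<close>. If the leading coefficient of
            \<open>Q a\<close> vanishes, \<open>Q\<close> is replaced by its truncation, whence the
            induction on the formal degree.\<close>
          have zeros: "sgn (poly (P a) x) = sgn (poly (P b) (\<phi> x))"
            if "(Q, e) \<in> S" "Q a \<noteq> 0" "poly (Q a) x = 0" for Q e x
            using that
          proof (induction e arbitrary: Q)
            case 0
            then have "degree (Q a) \<le> 0" using param_poly_degree valid insert.prems(1) by blast
            then show ?case using 0 by (auto elim: degree_eq_zeroE)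
          next
            case (Suc e)
            have QF: "(Q, Suc e) \<in> F" using Suc.prems insert.prems by auto
            have em: "Suc e \<le> m" using insert.hyps(2)[OF Suc.prems(1)] p by simp
            show ?case
            proof (cases "coeff (Q a) (Suc e) = 0")
              case True
              then have "truncate_poly (Suc e) (Q a) = Q a" by (rule truncate_poly_lead_zero)
              then show ?thesis using Suc.IH[OF low[OF op(2)[OF QF]]] Suc.prems em by simp
            next
              case False
              then have False': "coeff (Q b) (Suc e) \<noteq> 0" using lead[OF QF] by (metis sgn_0_0)
              obtain R where R: "(R, e) \<in> F" "sign_remainder P Q (Suc e) R"
                using remd[OF PF QF em] by blast
              have "sgn (poly (Q b) (\<phi> x)) = 0"
                using \<phi>(3)[OF Suc.prems(1), of x] Suc.prems(3) by simp
              then have "poly (Q b) (\<phi> x) = 0" by (simp only: sgn_0_0)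
              then have "sgn (poly (P b) (\<phi> x)) = sgn (poly (R b) (\<phi> x))"
                using R(2) False' unfolding sign_remainder_def by blast
              moreover have "sgn (poly (P a) x) = sgn (poly (R a) x)"
                using R(2) False Suc.prems(3) unfolding sign_remainder_def by blast
              moreover have "sgn (poly (R a) x) = sgn (poly (R b) (\<phi> x))"
                using \<phi>(3)[OF low[OF R(1)]] em by simp
              ultimately show ?thesis by simp
            qed
          qed
          have "\<exists>\<psi>. strict_mono \<psi> \<and> surj \<psi> \<and>
            (\<forall>r\<in>S. \<forall>x. sgn (poly (fst r a) x) = sgn (poly (fst r b) (\<psi> x))) \<and>
            (\<forall>x. sgn (poly (P a) x) = sgn (poly (P b) (\<psi> x)))"
          proof (rule extend_sign_homeo[where k = "(\<lambda>a. pderiv (P a), d)" and \<phi> = \<phi>])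
            show "(\<lambda>a. pderiv (P a), d) \<in> S" using low[OF opP(1)] Suc by simp
            show "sgn (poly (P a) x) = sgn (poly (P b) (\<phi> x))"
              if "r \<in> S" "fst r a \<noteq> 0" "poly (fst r a) x = 0" for r x
              using zeros[of "fst r" "snd r" x] that by simp
          qed (use insert.hyps(1) \<phi> deg leadP in auto)
          then show ?thesis using p by auto
        qed
      qed
    qed
    have "\<forall>r\<in>F. \<forall>q\<in>F. snd q < snd r \<longrightarrow> q \<in> F" by simp
    from extend[OF F(2) subset_refl this] obtain \<phi> where \<phi>: "strict_mono \<phi>" "surj \<phi>"
      "\<forall>p\<in>F. \<forall>x. sgn (poly (fst p a) x) = sgn (poly (fst p b) (\<phi> x))"
      by (elim exE conjE)
    have "sgn (poly (P a) x) = sgn (poly (P b) (\<phi> x))" if "P \<in> G" for P x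
    proof -
      have "(P, dg P) \<in> F" using F(1) that by auto
      from \<phi>(3)[rule_format, OF this] show ?thesis by simp
    qed
    then show ?thesis using \<phi>(1,2) by blast
  qed
  moreover have "finite Q" "\<forall>q\<in>Q. real_polynomial_function q"
    unfolding Q_def using F(2) by (auto intro: param_poly_coeff[OF valid])
  ultimately show ?thesis by blast
qed

section \<open>Interchange of integrals in the plane\<close>

text \<open>Integrability of all sections and of both inner integrals is part of the notion because
  additivity of the integral depends on it; this makes the notion stable under linear
  combinations.\<close>

definition fubini :: "(real \<Rightarrow> real \<Rightarrow> real) \<Rightarrow> bool" where
  "fubini h \<longleftrightarrow>
    (\<forall>x. schanuel_integrable1 (h x)) \<and> schanuel_integrable1 (\<lambda>x. schanuel_integral1 (h x)) \<and>
    (\<forall>y. schanuel_integrable1 (\<lambda>x. h x y)) \<and> schanuel_integrable1 (\<lambda>y. schanuel_integral1 (\<lambda>x. h x y)) \<and>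
    schanuel_integral1 (\<lambda>x. schanuel_integral1 (h x)) = schanuel_integral1 (\<lambda>y. schanuel_integral1 (\<lambda>x. h x y))"

lemma fubini_add:
  assumes "fubini h" "fubini k" shows "fubini (\<lambda>x y. h x y + k x y)"
proof -
  note h = assms(1)[unfolded fubini_def] and k = assms(2)[unfolded fubini_def]
  have x: "schanuel_integrable1 (h x)" "schanuel_integrable1 (k x)" for x using h k by auto
  have y: "schanuel_integrable1 (\<lambda>x. h x y)" "schanuel_integrable1 (\<lambda>x. k x y)" for y using h k by auto
  have X: "schanuel_integrable1 (\<lambda>x. schanuel_integral1 (h x))" "schanuel_integrable1 (\<lambda>x. schanuel_integral1 (k x))"
    using h k by auto
  have Y: "schanuel_integrable1 (\<lambda>y. schanuel_integral1 (\<lambda>x. h x y))"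
    "schanuel_integrable1 (\<lambda>y. schanuel_integral1 (\<lambda>x. k x y))"
    using h k by auto
  show ?thesis
    unfolding fubini_def schanuel1_add(2)[OF x] schanuel1_add(2)[OF y] schanuel1_add(2)[OF X] schanuel1_add(2)[OF Y]
    using schanuel1_add(1)[OF x] schanuel1_add(1)[OF y] schanuel1_add(1)[OF X] schanuel1_add(1)[OF Y] h k
    by presburger
qed

lemma fubini_prod:
  assumes "schanuel_integrable1 u" "schanuel_integrable1 v" shows "fubini (\<lambda>x y. u x * v y)"
proof -
  have 1: "schanuel_integral1 (\<lambda>y. u x * v y) = u x * schanuel_integral1 v" for x
    using schanuel1_cmult(2)[OF assms(2)] .
  have 2: "schanuel_integral1 (\<lambda>x. u x * v y) = v y * schanuel_integral1 u" for y
    using schanuel1_cmult(2)[OF assms(1), of "v y"] by (simp add: mult.commute)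
  have 3: "schanuel_integrable1 (\<lambda>y. u x * v y)" for x
    using schanuel1_cmult(1)[OF assms(2)] .
  have 4: "schanuel_integrable1 (\<lambda>x. u x * v y)" for y
    using schanuel1_cmult(1)[OF assms(1), of "v y"] by (simp add: mult.commute)
  show ?thesis
    unfolding fubini_def 1 2
    using 3 4 schanuel1_cmult[OF assms(1), of "schanuel_integral1 v"] schanuel1_cmult[OF assms(2), of "schanuel_integral1 u"]
    by (simp add: mult.commute)
qed

lemma fubini_cmult:
  assumes "fubini h" shows "fubini (\<lambda>x y. c * h x y)"
proof -
  note h = assms[unfolded fubini_def]
  have x: "schanuel_integrable1 (h x)" for x using h by auto
  have y: "schanuel_integrable1 (\<lambda>x. h x y)" for y using h by auto
  have X: "schanuel_integrable1 (\<lambda>x. schanuel_integral1 (h x))" using h by auto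
  have Y: "schanuel_integrable1 (\<lambda>y. schanuel_integral1 (\<lambda>x. h x y))" using h by auto
  show ?thesis
    unfolding fubini_def schanuel1_cmult(2)[OF x] schanuel1_cmult(2)[OF y] schanuel1_cmult(2)[OF X] schanuel1_cmult(2)[OF Y]
    using schanuel1_cmult(1)[OF x] schanuel1_cmult(1)[OF y] schanuel1_cmult(1)[OF X] schanuel1_cmult(1)[OF Y] h
    by presburger
qed

lemma fubini_zero: "fubini (\<lambda>x y. 0)"
  using fubini_prod[OF schanuel1_const(1)[of 0] schanuel1_const(1)[of 0]] by (simp only: mult_zero_left)

lemma fubini_sum:
  assumes "\<And>i. i \<in> S \<Longrightarrow> fubini (h i)" shows "fubini (\<lambda>x y. \<Sum>i\<in>S. h i x y)"
  using assms
proof (induction S rule: infinite_finite_induct)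
  case (insert i S)
  then show ?case using fubini_add[of "h i" "\<lambda>x y. \<Sum>i\<in>S. h i x y"] by simp
qed (simp_all add: fubini_zero)

definition monotone_or_constant_on :: "real set \<Rightarrow> (real \<Rightarrow> real) \<Rightarrow> bool" where
  "monotone_or_constant_on J r \<longleftrightarrow> strict_mono_on J r \<or> strict_antimono_on J r \<or> (\<exists>c. \<forall>x\<in>J. r x = c)"

text \<open>Between two points such an \<open>r\<close> never drops below both of its end
  values.\<close>

lemma convex_superlevel:
  assumes J: "convex J" and r: "monotone_or_constant_on J r"
  shows "convex {x \<in> J. y < r x}"
proof -
  have iv: "z \<in> J" if "a \<in> J" "b \<in> J" "a \<le> z" "z \<le> b" for a b z
    using J that unfolding is_interval_convex_1[symmetric] is_interval_1 by blast
  have "z \<in> J \<and> y < r z" if ab: "a \<in> J" "y < r a" "b \<in> J" "y < r b" "a \<le> z" "z \<le> b" for a b z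
  proof -
    have zJ: "z \<in> J" using iv ab by blast
    have "r a \<le> r z \<or> r b \<le> r z"
      using r unfolding monotone_or_constant_on_def
      using ab zJ by (auto simp: monotone_on_def order_le_less)
    then show ?thesis using zJ ab by auto
  qed
  then show ?thesis unfolding is_interval_convex_1[symmetric] is_interval_1 by blast
qed

text \<open>Vertical sections over \<open>J\<close> are rays. Horizontal sections \<open>L y\<close>
  are open intervals, nonempty exactly for \<open>y\<close> in the projection \<open>D\<close>,
  which is an open interval too. For nonempty \<open>J\<close> both orders therefore give (-1) times
  (-1).\<close>

lemma fubini_below:
  assumes J: "open J" "convex J" and cont: "continuous_on J r" and r: "monotone_or_constant_on J r"
  shows "fubini (\<lambda>x y. if x \<in> J \<and> y < r x then 1 else 0)" (is "fubini ?h")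
proof -
  have hx: "?h x = (\<lambda>y. (if x \<in> J then 1 else 0) * (if y < r x then 1 else 0))" for x by auto
  have 1: "schanuel_integrable1 (?h x)" for x
    unfolding hx by (rule schanuel1_cmult(1)[OF schanuel1_less(1)])
  have 2: "schanuel_integral1 (?h x) = -1 * (if x \<in> J then 1 else 0)" for x
    unfolding hx by (simp add: schanuel1_cmult(2)[OF schanuel1_less(1)] schanuel1_less(2))
  define L where "L = (\<lambda>y. {x \<in> J. y < r x})"
  have hy: "(\<lambda>x. ?h x y) = (\<lambda>x. if x \<in> L y then 1 else 0)" for y by (auto simp: L_def)
  have oL: "open (L y)" for y
  proof -
    have "open (J \<inter> r -` {y<..})" using continuous_open_preimage[OF cont J(1)] by simp
    moreover have "J \<inter> r -` {y<..} = L y" by (auto simp: L_def)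
    ultimately show ?thesis by simp
  qed
  have cL: "convex (L y)" for y unfolding L_def by (rule convex_superlevel[OF J(2) r])
  have 3: "schanuel_integrable1 (\<lambda>x. ?h x y)" for y
    unfolding hy by (rule schanuel1_open_convex(1)[OF oL cL])
  define D where "D = (\<Union>x\<in>J. {..<r x})"
  have oD: "open D" unfolding D_def by (intro open_UN ballI open_lessThan)
  have cD: "convex D"
    unfolding is_interval_convex_1[symmetric] is_interval_1 D_def by (auto intro: le_less_trans)
  have D: "D = {} \<longleftrightarrow> J = {}" unfolding D_def by auto
  have 4: "schanuel_integral1 (\<lambda>x. ?h x y) = -1 * (if y \<in> D then 1 else 0)" for y
    unfolding hy schanuel1_open_convex(2)[OF oL cL] by (auto simp: L_def D_def)
  show ?thesis
    unfolding fubini_def 2 4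
    using 1 3 schanuel1_cmult[OF schanuel1_open_convex(1)[OF J], of "-1"]
      schanuel1_cmult[OF schanuel1_open_convex(1)[OF oD cD], of "-1"]
      schanuel1_open_convex(2)[OF J] schanuel1_open_convex(2)[OF oD cD] D
    by simp
qed

text \<open>For constant \<open>r\<close> the indicator is a product. Otherwise \<open>r\<close> is
  injective, so it maps \<open>J\<close> onto an open interval and every section, in either
  direction, is a point or empty. Both orders then integrate the indicator of an open interval,
  \<open>J\<close> or its image.\<close>

lemma fubini_graph:
  assumes J: "open J" "convex J" and cont: "continuous_on J r" and r: "monotone_or_constant_on J r"
  shows "fubini (\<lambda>x y. if x \<in> J \<and> y = r x then 1 else 0)" (is "fubini ?h")
proof (cases "\<exists>c. \<forall>x\<in>J. r x = c")
  case True
  then obtain c where c: "\<And>x. x \<in> J \<Longrightarrow> r x = c" by blast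
  have "?h = (\<lambda>x y. (if x \<in> J then 1 else 0) * (if y = c then 1 else 0))" using c by (auto simp: fun_eq_iff)
  then show ?thesis
    using fubini_prod[OF schanuel1_open_convex(1)[OF J] schanuel1_point(1)[of c]] by simp
next
  case False
  then have inj: "inj_on r J"
    using r unfolding monotone_or_constant_on_def
    by (auto simp: strict_mono_on_imp_inj_on inj_on_def monotone_on_def) (metis less_irrefl linorder_cases)+
  have hx: "?h x = (\<lambda>y. (if x \<in> J then 1 else 0) * (if y = r x then 1 else 0))" for x by auto
  have 1: "schanuel_integrable1 (?h x)" for x
    unfolding hx by (rule schanuel1_cmult(1)[OF schanuel1_point(1)])
  have 2: "schanuel_integral1 (?h x) = (if x \<in> J then 1 else 0)" for x
    unfolding hx by (simp add: schanuel1_cmult(2)[OF schanuel1_point(1)] schanuel1_point(2))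
  define k where "k = the_inv_into J r"
  have hy: "(\<lambda>x. ?h x y) = (\<lambda>x. (if y \<in> r ` J then 1 else 0) * (if x = k y then 1 else 0))" for y
    using inj by (auto simp: k_def the_inv_into_f_f fun_eq_iff)
  have 3: "schanuel_integrable1 (\<lambda>x. ?h x y)" for y
    unfolding hy by (rule schanuel1_cmult(1)[OF schanuel1_point(1)])
  have 4: "schanuel_integral1 (\<lambda>x. ?h x y) = (if y \<in> r ` J then 1 else 0)" for y
    unfolding hy by (simp add: schanuel1_cmult(2)[OF schanuel1_point(1)] schanuel1_point(2))
  have o: "open (r ` J)" using injective_into_1d_imp_open_map_UNIV[OF J(1) cont inj] by simp
  have c: "convex (r ` J)"
    using connected_continuous_image[OF cont convex_connected[OF J(2)]] by (simp add: connected_convex_1)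
  show ?thesis
    unfolding fubini_def 2 4
    using 1 3 schanuel1_open_convex[OF J] schanuel1_open_convex[OF o c] by simp
qed

section \<open>Root branches as implicit functions: slope and continuity\<close>

lemma MVT_unordered:
  fixes f :: "real \<Rightarrow> real"
  assumes "\<And>x. (f has_real_derivative f' x) (at x)"
  shows "\<exists>z. \<bar>z - a\<bar> \<le> \<bar>b - a\<bar> \<and> f b - f a = f' z * (b - a)"
proof -
  consider "a < b" | "a = b" | "b < a" by linarith
  then show ?thesis
  proof cases
    case 1
    then obtain z where "a < z" "z < b" "f b - f a = (b - a) * f' z" using MVT2[of a b f f'] assms by blast
    then show ?thesis by (intro exI[of _ z]) auto
  next
    case 3
    then obtain z where "b < z" "z < a" "f a - f b = (a - b) * f' z" using MVT2[of b a f f'] assms by blast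
    then show ?thesis by (intro exI[of _ z]) (auto simp: algebra_simps)
  qed auto
qed

text \<open>The branch \<open>g\<close> is given and known to be continuous, so only its slope is at
  stake. The change of \<open>p\<close> from \<open>(x0, g x0)\<close> to \<open>(x, g x)\<close> is
  zero; splitting it into a vertical and a horizontal part and applying the mean value theorem to
  each expresses the difference quotient of \<open>g\<close> by the partial derivatives at points
  tending to \<open>(x0, g x0)\<close>.\<close>

lemma implicit_derivative:
  fixes p px py :: "real \<Rightarrow> real \<Rightarrow> real"
  assumes J: "open J" "x0 \<in> J" and g: "isCont g x0" "\<And>x. x \<in> J \<Longrightarrow> p x (g x) = 0"
    and px: "\<And>x y. ((\<lambda>x. p x y) has_real_derivative px x y) (at x)"
    and py: "\<And>x y. (p x has_real_derivative py x y) (at y)"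
    and cpx: "isCont (\<lambda>(x, y). px x y) (x0, g x0)" and cpy: "isCont (py x0) (g x0)"
    and nz: "py x0 (g x0) \<noteq> 0"
  shows "(g has_real_derivative - (px x0 (g x0) / py x0 (g x0))) (at x0)"
proof -
  have "\<exists>z. \<bar>z - x0\<bar> \<le> \<bar>x - x0\<bar> \<and> p x (g x) - p x0 (g x) = px z (g x) * (x - x0)" for x
    using MVT_unordered[of "\<lambda>x'. p x' (g x)" "\<lambda>x'. px x' (g x)"] px by blast
  then obtain \<xi> where \<xi>: "\<And>x. \<bar>\<xi> x - x0\<bar> \<le> \<bar>x - x0\<bar>"
    "\<And>x. p x (g x) - p x0 (g x) = px (\<xi> x) (g x) * (x - x0)" by metis
  have "\<exists>z. \<bar>z - g x0\<bar> \<le> \<bar>g x - g x0\<bar> \<and> p x0 (g x) - p x0 (g x0) = py x0 z * (g x - g x0)" for x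
    using MVT_unordered[of "p x0" "py x0"] py by blast
  then obtain \<eta> where \<eta>: "\<And>x. \<bar>\<eta> x - g x0\<bar> \<le> \<bar>g x - g x0\<bar>"
    "\<And>x. p x0 (g x) - p x0 (g x0) = py x0 (\<eta> x) * (g x - g x0)" by metis
  have gl: "(g \<longlongrightarrow> g x0) (at x0)" using g(1) by (simp add: isCont_def)
  have \<xi>l: "(\<xi> \<longlongrightarrow> x0) (at x0)"
  proof (rule Lim_transform_bound[of "\<lambda>x. \<xi> x - x0" "\<lambda>x. x - x0", THEN LIM_zero_cancel])
    show "\<forall>\<^sub>F n in at x0. norm (\<xi> n - x0) \<le> norm (n - x0)" using \<xi>(1) by simp
    show "((\<lambda>x. x - x0) \<longlongrightarrow> 0) (at x0)" by (auto intro!: tendsto_eq_intros)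
  qed
  have \<eta>l: "(\<eta> \<longlongrightarrow> g x0) (at x0)"
  proof (rule Lim_transform_bound[of "\<lambda>x. \<eta> x - g x0" "\<lambda>x. g x - g x0", THEN LIM_zero_cancel])
    show "\<forall>\<^sub>F n in at x0. norm (\<eta> n - g x0) \<le> norm (g n - g x0)" using \<eta>(1) by simp
    show "((\<lambda>x. g x - g x0) \<longlongrightarrow> 0) (at x0)" using gl by (rule LIM_zero)
  qed
  have pxl: "((\<lambda>x. px (\<xi> x) (g x)) \<longlongrightarrow> px x0 (g x0)) (at x0)"
    using isCont_tendsto_compose[OF cpx tendsto_Pair[OF \<xi>l gl]] by simp
  have pyl: "((\<lambda>x. py x0 (\<eta> x)) \<longlongrightarrow> py x0 (g x0)) (at x0)"
    using isCont_tendsto_compose[OF cpy \<eta>l] .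
  have "((\<lambda>x. - (px (\<xi> x) (g x) / py x0 (\<eta> x))) \<longlongrightarrow> - (px x0 (g x0) / py x0 (g x0))) (at x0)"
    by (intro tendsto_intros pxl pyl nz)
  moreover have "\<forall>\<^sub>F x in at x0. - (px (\<xi> x) (g x) / py x0 (\<eta> x)) = (g x - g x0) / (x - x0)"
  proof -
    have "\<forall>\<^sub>F x in at x0. py x0 (\<eta> x) \<noteq> 0" using tendsto_imp_eventually_ne[OF pyl nz] .
    moreover have "\<forall>\<^sub>F x in at x0. x \<in> J" using J eventually_at_in_open' by blast
    moreover have "\<forall>\<^sub>F x in at x0. x \<noteq> x0" by (simp add: eventually_at_filter)
    ultimately show ?thesis
    proof eventually_elim
      case (elim x)
      have "p x (g x) - p x0 (g x0) = px (\<xi> x) (g x) * (x - x0) + py x0 (\<eta> x) * (g x - g x0)"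
        using \<xi>(2)[of x] \<eta>(2)[of x] by simp
      then have "px (\<xi> x) (g x) * (x - x0) + py x0 (\<eta> x) * (g x - g x0) = 0"
        using g(2) J(2) elim by simp
      then show ?case using elim by (simp add: field_simps)
    qed
  qed
  ultimately have "((\<lambda>x. (g x - g x0) / (x - x0)) \<longlongrightarrow> - (px x0 (g x0) / py x0 (g x0))) (at x0)"
    by (rule Lim_transform_eventually)
  then show ?thesis by (simp add: has_field_derivative_iff)
qed

text \<open>The least point that is moved down would have an image that is moved down as well;
  dually for points moved up. This identifies roots of neighbouring sections by their rank.\<close>

lemma strict_mono_self_map_id:
  fixes j :: "'a::linorder \<Rightarrow> 'a"
  assumes "finite R" "j ` R \<subseteq> R" "\<And>\<rho> \<sigma>. \<rho> \<in> R \<Longrightarrow> \<sigma> \<in> R \<Longrightarrow> \<rho> < \<sigma> \<Longrightarrow> j \<rho> < j \<sigma>" and \<rho>: "\<rho> \<in> R"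
  shows "j \<rho> = \<rho>"
proof (rule ccontr)
  assume "j \<rho> \<noteq> \<rho>"
  then consider "j \<rho> < \<rho>" | "j \<rho> > \<rho>" by fastforce
  then show False
  proof cases
    case 1
    let ?S = "{\<rho> \<in> R. j \<rho> < \<rho>}"
    have S: "finite ?S" "?S \<noteq> {}" using assms 1 by auto
    have m: "Min ?S \<in> R" "j (Min ?S) < Min ?S" using Min_in[OF S] by auto
    then have "j (Min ?S) \<in> ?S" using assms(2,3) by auto
    then show False using Min_le[OF S(1)] m(2) by (meson not_le)
  next
    case 2
    let ?S = "{\<rho> \<in> R. j \<rho> > \<rho>}"
    have S: "finite ?S" "?S \<noteq> {}" using assms 2 by auto
    have m: "Max ?S \<in> R" "j (Max ?S) > Max ?S" using Max_in[OF S] by auto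
    then have "j (Max ?S) \<in> ?S" using assms(2,3) by auto
    then show False using Max_ge[OF S(1)] m(2) by (meson not_le)
  qed
qed

lemma eventually_opposite_signs:
  fixes f :: "real \<Rightarrow> real"
  assumes "(f has_real_derivative D) (at y)" "f y = 0" "D \<noteq> 0"
  shows "\<forall>\<^sub>F h in at_right 0. f (y - h) * f (y + h) < 0"
proof (cases "D > 0")
  case True
  obtain d1 where d1: "d1 > 0" "\<And>h. 0 < h \<Longrightarrow> h < d1 \<Longrightarrow> f y < f (y + h)"
    using DERIV_pos_inc_right[OF assms(1) True] by blast
  obtain d2 where d2: "d2 > 0" "\<And>h. 0 < h \<Longrightarrow> h < d2 \<Longrightarrow> f (y - h) < f y"
    using DERIV_pos_inc_left[OF assms(1) True] by blast
  show ?thesis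
    unfolding eventually_at_right_field using d1 d2 assms(2)
    by (intro exI[of _ "min d1 d2"]) (auto simp: mult_less_0_iff)
next
  case False
  then have False: "D < 0" using assms(3) by simp
  obtain d1 where d1: "d1 > 0" "\<And>h. 0 < h \<Longrightarrow> h < d1 \<Longrightarrow> f y > f (y + h)"
    using DERIV_neg_dec_right[OF assms(1) False] by blast
  obtain d2 where d2: "d2 > 0" "\<And>h. 0 < h \<Longrightarrow> h < d2 \<Longrightarrow> f (y - h) > f y"
    using DERIV_neg_dec_left[OF assms(1) False] by blast
  show ?thesis
    unfolding eventually_at_right_field using d1 d2 assms(2)
    by (intro exI[of _ "min d1 d2"]) (auto simp: mult_less_0_iff)
qed

text \<open>Near \<open>x\<^sub>1\<close> every root persists, and as the number of roots is constant, no others appear.\<close>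

lemma roots_continuous:
  fixes \<phi> :: "real \<Rightarrow> real \<Rightarrow> real" and p :: "real \<Rightarrow> real \<Rightarrow> real \<Rightarrow> real"
  assumes R: "finite R" and J: "open J" "x1 \<in> J"
    and mono: "\<And>x. x \<in> J \<Longrightarrow> strict_mono (\<phi> x)"
    and roots: "\<And>x y \<rho>. x \<in> J \<Longrightarrow> \<rho> \<in> R \<Longrightarrow> p \<rho> x y = 0 \<Longrightarrow> y \<in> \<phi> x ` R"
    and zero: "\<And>\<rho>. \<rho> \<in> R \<Longrightarrow> p \<rho> x1 (\<phi> x1 \<rho>) = 0"
    and deriv: "\<And>\<rho>. \<rho> \<in> R \<Longrightarrow> (p \<rho> x1 has_real_derivative D \<rho>) (at (\<phi> x1 \<rho>))" "\<And>\<rho>. \<rho> \<in> R \<Longrightarrow> D \<rho> \<noteq> 0"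
    and contx: "\<And>\<rho> y. \<rho> \<in> R \<Longrightarrow> isCont (\<lambda>x. p \<rho> x y) x1"
    and conty: "\<And>\<rho> x. \<rho> \<in> R \<Longrightarrow> continuous_on UNIV (p \<rho> x)"
    and \<rho>: "\<rho> \<in> R"
  shows "isCont (\<lambda>x. \<phi> x \<rho>) x1"
  unfolding isCont_def tendsto_iff
proof (intro allI impI)
  fix e :: real assume e: "e > 0"
  have 1: "\<forall>\<^sub>F h in at_right 0. h < e"
    unfolding eventually_at_right_field using e by auto
  have 2: "\<forall>\<^sub>F h in at_right 0. \<forall>\<rho>\<in>R. p \<rho> x1 (\<phi> x1 \<rho> - h) * p \<rho> x1 (\<phi> x1 \<rho> + h) < 0"
    using R eventually_opposite_signs[OF deriv(1) zero deriv(2)] by (simp add: eventually_ball_finite)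
  have "\<forall>\<^sub>F h in at_right 0. \<rho> < \<sigma> \<longrightarrow> \<phi> x1 \<rho> + h < \<phi> x1 \<sigma> - h" for \<rho> \<sigma>
  proof (cases "\<rho> < \<sigma>")
    case True
    then have "\<phi> x1 \<rho> < \<phi> x1 \<sigma>" using mono[OF J(2)] by (simp add: strict_mono_less)
    then show ?thesis
      unfolding eventually_at_right_field by (intro exI[of _ "(\<phi> x1 \<sigma> - \<phi> x1 \<rho>) / 2"]) auto
  qed auto
  then have 3: "\<forall>\<^sub>F h in at_right 0. \<forall>\<rho>\<in>R. \<forall>\<sigma>\<in>R. \<rho> < \<sigma> \<longrightarrow> \<phi> x1 \<rho> + h < \<phi> x1 \<sigma> - h"
    using R by (simp add: eventually_ball_finite)
  have 4: "\<forall>\<^sub>F h in at_right 0. (0::real) < h"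
    unfolding eventually_at_right_field by (auto intro: exI[of _ 1])
  \<comment> \<open>\<open>h\<close> is the radius of brackets around the roots over
    \<open>x1\<close>, small enough for them to be disjoint, with \<open>p \<rho>\<close> changing
    sign across the bracket of \<open>\<rho>\<close>. Opposite signs at the ends persist for
    \<open>x\<close> near \<open>x1\<close> and force a root in each bracket.\<close>
  have "\<forall>\<^sub>F h in at_right 0. 0 < h \<and> h < e \<and> (\<forall>\<rho>\<in>R. p \<rho> x1 (\<phi> x1 \<rho> - h) * p \<rho> x1 (\<phi> x1 \<rho> + h) < 0) \<and>
    (\<forall>\<rho>\<in>R. \<forall>\<sigma>\<in>R. \<rho> < \<sigma> \<longrightarrow> \<phi> x1 \<rho> + h < \<phi> x1 \<sigma> - h)"
    using 1 2 3 4 by eventually_elim auto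
  then obtain h where h: "0 < h" "h < e" "\<And>\<rho>. \<rho> \<in> R \<Longrightarrow> p \<rho> x1 (\<phi> x1 \<rho> - h) * p \<rho> x1 (\<phi> x1 \<rho> + h) < 0"
    "\<And>\<rho> \<sigma>. \<rho> \<in> R \<Longrightarrow> \<sigma> \<in> R \<Longrightarrow> \<rho> < \<sigma> \<Longrightarrow> \<phi> x1 \<rho> + h < \<phi> x1 \<sigma> - h"
    using eventually_happens'[OF trivial_limit_at_right_real] by blast
  have "\<forall>\<^sub>F x in at x1. p \<rho> x (\<phi> x1 \<rho> - h) * p \<rho> x (\<phi> x1 \<rho> + h) < 0" if "\<rho> \<in> R" for \<rho>
  proof -
    have "((\<lambda>x. p \<rho> x (\<phi> x1 \<rho> - h) * p \<rho> x (\<phi> x1 \<rho> + h)) \<longlongrightarrow> p \<rho> x1 (\<phi> x1 \<rho> - h) * p \<rho> x1 (\<phi> x1 \<rho> + h)) (at x1)"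
      using contx[OF that] unfolding isCont_def by (intro tendsto_mult)
    then show ?thesis using h(3)[OF that] by (rule order_tendstoD(2))
  qed
  then have "\<forall>\<^sub>F x in at x1. \<forall>\<rho>\<in>R. p \<rho> x (\<phi> x1 \<rho> - h) * p \<rho> x (\<phi> x1 \<rho> + h) < 0"
    using R by (simp add: eventually_ball_finite)
  moreover have "\<forall>\<^sub>F x in at x1. x \<in> J" using J eventually_at_in_open' by blast
  ultimately show "\<forall>\<^sub>F x in at x1. dist (\<phi> x \<rho>) (\<phi> x1 \<rho>) < e"
  proof eventually_elim
    case (elim x)
    have "\<exists>\<sigma>\<in>R. \<phi> x1 \<rho> - h < \<phi> x \<sigma> \<and> \<phi> x \<sigma> < \<phi> x1 \<rho> + h" if \<rho>R: "\<rho> \<in> R" for \<rho>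
    proof -
      let ?l = "\<phi> x1 \<rho> - h" and ?u = "\<phi> x1 \<rho> + h"
      have neg: "p \<rho> x ?l * p \<rho> x ?u < 0" using elim \<rho>R by blast
      have c: "continuous_on {?l..?u} (p \<rho> x)" using conty[OF \<rho>R] continuous_on_subset by blast
      have "\<exists>y\<ge>?l. y \<le> ?u \<and> p \<rho> x y = 0"
      proof (cases "p \<rho> x ?l < 0")
        case True
        then have "p \<rho> x ?u > 0" using neg by (simp add: mult_less_0_iff)
        then show ?thesis using True h(1) IVT'[of "p \<rho> x" ?l 0 ?u] c by simp
      next
        case False
        then have "p \<rho> x ?l > 0" "p \<rho> x ?u < 0" using neg by (auto simp: mult_less_0_iff)
        then show ?thesis using h(1) IVT2'[of "p \<rho> x" ?u 0 ?l] c by simp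
      qed
      then obtain y where y: "?l \<le> y" "y \<le> ?u" "p \<rho> x y = 0" by blast
      then have "y \<noteq> ?l" "y \<noteq> ?u" using neg by auto
      then have "?l < y" "y < ?u" using y by auto
      moreover obtain \<sigma> where "\<sigma> \<in> R" "y = \<phi> x \<sigma>" using roots[OF elim(2) \<rho>R y(3)] by blast
      ultimately show ?thesis by blast
    qed
    \<comment> \<open>\<open>\<phi> x (j \<rho>)\<close> is a root over \<open>x\<close> in the
      bracket of \<open>\<rho>\<close>. The brackets are ordered like the roots, so \<open>j\<close>
      is increasing on the finite set \<open>R\<close> and hence the identity: the root of the same
      index stays within \<open>h\<close>.\<close>
    then obtain j where j: "\<And>\<rho>. \<rho> \<in> R \<Longrightarrow> j \<rho> \<in> R"
      "\<And>\<rho>. \<rho> \<in> R \<Longrightarrow> \<phi> x1 \<rho> - h < \<phi> x (j \<rho>)" "\<And>\<rho>. \<rho> \<in> R \<Longrightarrow> \<phi> x (j \<rho>) < \<phi> x1 \<rho> + h" by metis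
    have "j \<rho> = \<rho>"
    proof (rule strict_mono_self_map_id[OF R _ _ \<rho>])
      fix \<rho> \<sigma> assume "\<rho> \<in> R" "\<sigma> \<in> R" "\<rho> < \<sigma>"
      then have "\<phi> x (j \<rho>) < \<phi> x (j \<sigma>)" using j(2)[of \<sigma>] j(3)[of \<rho>] h(4)[of \<rho> \<sigma>] by linarith
      then show "j \<rho> < j \<sigma>" using mono[OF elim(2)] by (simp add: strict_mono_less)
    qed (use j(1) in auto)
    then show ?case using j(2,3)[OF \<rho>] h(2) by (simp add: dist_real_def abs_less_iff)
  qed
qed

section \<open>Differentiation of polynomials with a real parameter\<close>

lemma poly_eq_sum_of_degree_le:
  fixes p :: "real poly"
  assumes "degree p \<le> d" shows "poly p y = (\<Sum>j\<le>d. coeff p j * y ^ j)"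
proof -
  have "poly p y = poly (\<Sum>j\<le>d. monom (coeff p j) j) y"
    using poly_as_sum_of_monoms'[OF assms] by simp
  then show ?thesis by (simp add: poly_sum poly_monom)
qed

lemma param_poly_has_derivative:
  fixes P :: "real \<Rightarrow> real poly"
  assumes P: "param_poly P d"
  shows "\<exists>P'. param_poly P' d \<and> (\<forall>x y. ((\<lambda>x. poly (P x) y) has_real_derivative poly (P' x) y) (at x))"
proof -
  have "\<forall>j. \<exists>c'. real_polynomial_function c' \<and> (\<forall>x. ((\<lambda>x. coeff (P x) j) has_real_derivative c' x) (at x))"
    using has_real_derivative_polynomial_function[OF param_poly_coeff[OF P]] by metis
  then obtain c' where c': "\<And>j. real_polynomial_function (c' j)"
    "\<And>j x. ((\<lambda>x. coeff (P x) j) has_real_derivative c' j x) (at x)" by metis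
  define P' where "P' = (\<lambda>x. \<Sum>j\<le>d. monom (c' j x) j)"
  have coeff: "coeff (P' x) j = (if j \<le> d then c' j x else 0)" for x j
    unfolding P'_def by (simp add: coeff_sum sum.delta)
  have "real_polynomial_function (\<lambda>x. coeff (P' x) j)" for j
    using c'(1) real_polynomial_function.intros(2)[of 0] unfolding coeff by (cases "j \<le> d") simp_all
  then have "param_poly P' d"
    unfolding param_poly_def by (auto intro: degree_le simp: coeff)
  moreover have "((\<lambda>x. poly (P x) y) has_real_derivative poly (P' x) y) (at x)" for x y
  proof -
    have 1: "(\<lambda>x. poly (P x) y) = (\<lambda>x. \<Sum>j\<le>d. coeff (P x) j * y ^ j)"
      using poly_eq_sum_of_degree_le[OF param_poly_degree[OF P]] by blast
    have 2: "poly (P' x) y = (\<Sum>j\<le>d. c' j x * y ^ j)"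
      unfolding P'_def by (simp add: poly_sum poly_monom)
    show ?thesis unfolding 1 2
      by (intro DERIV_sum DERIV_cmult_right c'(2))
  qed
  ultimately show ?thesis by blast
qed

lemma param_poly_isCont:
  fixes P :: "real \<Rightarrow> real poly"
  assumes P: "param_poly P d"
  shows "isCont (\<lambda>(x, y). poly (P x) y) z" "isCont (\<lambda>x. poly (P x) y) x"
proof -
  have c: "isCont (\<lambda>x. coeff (P x) j) x" for j x
    using continuous_real_polymonial_function[OF param_poly_coeff[OF P]] .
  have 1: "(\<lambda>(x, y). poly (P x) y) = (\<lambda>z. \<Sum>j\<le>d. coeff (P (fst z)) j * snd z ^ j)"
    using poly_eq_sum_of_degree_le[OF param_poly_degree[OF P]] by (auto simp: fun_eq_iff)
  have "isCont (\<lambda>z. coeff (P (fst z)) j) z" for j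
    by (rule isCont_o2[OF isCont_fst[OF continuous_ident] c])
  then show "isCont (\<lambda>(x, y). poly (P x) y) z"
    unfolding 1 by (intro continuous_intros)
  have 2: "(\<lambda>x. poly (P x) y) = (\<lambda>x. \<Sum>j\<le>d. coeff (P x) j * y ^ j)"
    using poly_eq_sum_of_degree_le[OF param_poly_degree[OF P]] by (auto simp: fun_eq_iff)
  show "isCont (\<lambda>x. poly (P x) y) x"
    unfolding 2 by (intro continuous_intros c)
qed

lemma param_poly_higher_pderiv:
  assumes "param_poly P d" shows "param_poly (\<lambda>a. (pderiv ^^ k) (P a)) d"
proof (induction k)
  case (Suc k)
  show ?case
  proof (cases d)
    case 0
    have "pderiv ((pderiv ^^ k) (P a)) = 0" for a
      using param_poly_degree[OF Suc.IH, of a] 0 by (simp add: pderiv_eq_0_iff)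
    then show ?thesis by (simp add: param_poly_def real_polynomial_function.intros(2))
  next
    case (Suc d')
    then show ?thesis
      using param_poly_mono[OF param_poly_pderiv[OF Suc.IH[unfolded Suc]], of d] by simp
  qed
qed (use assms in simp)

text \<open>Differentiating further, one finally meets a derivative that does not vanish at
  \<open>\<rho>\<close>, at the latest the nonzero constant at order \<open>degree p\<close>. The
  one just before it has a simple root there. Thus multiple roots are handled by derivatives,
  without squarefree parts.\<close>

lemma higher_pderiv_root:
  fixes p :: "real poly"
  assumes "poly ((pderiv ^^ k) p) \<rho> = 0" "(pderiv ^^ k) p \<noteq> 0"
  shows "\<exists>m. m < degree p \<and> poly ((pderiv ^^ m) p) \<rho> = 0 \<and> poly (pderiv ((pderiv ^^ m) p)) \<rho> \<noteq> 0"
proof -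
  let ?S = "\<lambda>m. k \<le> m \<and> poly ((pderiv ^^ m) p) \<rho> \<noteq> 0"
  have p: "p \<noteq> 0" using assms(2) by auto
  have deg: "degree ((pderiv ^^ m) p) = degree p - m" for m
    by (induction m) (simp_all add: degree_pderiv)
  have "k \<le> degree p"
  proof (rule ccontr)
    assume k: "\<not> k \<le> degree p"
    then have "coeff ((pderiv ^^ k) p) n = 0" for n
      by (simp add: coeff_higher_pderiv coeff_eq_0)
    then show False using assms(2) by (simp add: poly_eq_iff)
  qed
  moreover have "poly ((pderiv ^^ degree p) p) \<rho> \<noteq> 0"
  proof -
    have "poly ((pderiv ^^ degree p) p) \<rho> = coeff ((pderiv ^^ degree p) p) 0"
      by (rule poly_degree_0) (simp add: deg)
    also have "\<dots> \<noteq> 0" using p by (simp add: coeff_higher_pderiv pochhammer_eq_0_iff pochhammer_fact[symmetric])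
    finally show ?thesis .
  qed
  ultimately have S: "?S (degree p)" by simp
  define m where "m = (LEAST m. ?S m)"
  have m: "?S m" unfolding m_def using S by (rule LeastI)
  have le: "m \<le> degree p" unfolding m_def using S by (rule Least_le)
  have "m \<noteq> k" using m assms(1) by auto
  then obtain m' where m': "m = Suc m'" "k \<le> m'" using m by (cases m) auto
  have "\<not> ?S m'" using not_less_Least[of m' ?S] m'(1) unfolding m_def by simp
  then have "poly ((pderiv ^^ m') p) \<rho> = 0" using m'(2) by blast
  then show ?thesis using m m' le by (intro exI[of _ m']) auto
qed

section \<open>Vertical strips and the planar interchange theorem\<close>

lemma polynomial_function_real_imp_poly:
  assumes "real_polynomial_function (q :: real \<Rightarrow> real)"
  shows "\<exists>p. q = poly p"
proof -
  obtain a n where "q = (\<lambda>x. \<Sum>i\<le>n. a i * x ^ i)"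
    using assms unfolding real_polynomial_function_iff_sum by blast
  then have "q = poly (\<Sum>i\<le>n. monom (a i) i)" by (auto simp: poly_sum poly_monom fun_eq_iff)
  then show ?thesis by blast
qed

text \<open>The component of the complement of \<open>C\<close> with exactly the points of
  \<open>B\<close> to its left. Indexing by all subsets avoids enumerating \<open>C\<close> in
  order: for \<open>B \<subseteq> C\<close> that is no initial segment the cell is empty.\<close>

definition cell :: "real set \<Rightarrow> real set \<Rightarrow> real set" where
  "cell C B = (\<Inter>c\<in>B. {c<..}) \<inter> (\<Inter>c\<in>C - B. {..<c})"

lemma cell_open_convex: "finite C \<Longrightarrow> B \<subseteq> C \<Longrightarrow> open (cell C B) \<and> convex (cell C B)"
  unfolding cell_def
  by (intro conjI open_Int convex_Int open_INT convex_INT ballI) (auto dest: finite_subset)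

lemma mem_cell_iff:
  assumes "B \<subseteq> C" shows "x \<in> cell C B \<longleftrightarrow> x \<notin> C \<and> {c \<in> C. c < x} = B"
proof
  assume "x \<in> cell C B"
  then have "\<And>c. c \<in> B \<Longrightarrow> c < x" "\<And>c. c \<in> C \<Longrightarrow> c \<notin> B \<Longrightarrow> x < c" by (auto simp: cell_def)
  then show "x \<notin> C \<and> {c \<in> C. c < x} = B"
    using assms by (auto dest: less_asym)
next
  assume *: "x \<notin> C \<and> {c \<in> C. c < x} = B"
  have "x < c" if "c \<in> C - B" for c
    using * that by (cases c x rule: linorder_cases) auto
  then show "x \<in> cell C B" using * by (auto simp: cell_def)
qed

lemma sum_over_cells:
  assumes "finite C"
  shows "(v::real) = (\<Sum>c\<in>C. (if x = c then 1 else 0) * v) + (\<Sum>B\<in>Pow C. (if x \<in> cell C B then 1 else 0) * v)"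
proof -
  have "(\<Sum>B\<in>Pow C. (if x \<in> cell C B then 1 else 0) * v) = 
    (\<Sum>B\<in>Pow C. if B = {c \<in> C. c < x} then (if x \<in> C then 0 else v) else 0)"
    by (intro sum.cong) (auto simp: mem_cell_iff)
  also have "\<dots> = (if x \<in> C then 0 else v)"
    using assms by (simp add: sum.delta)
  finally have 1: "(\<Sum>B\<in>Pow C. (if x \<in> cell C B then 1 else 0) * v) = (if x \<in> C then 0 else v)" .
  have "(\<Sum>c\<in>C. (if x = c then 1 else 0) * v) = (\<Sum>c\<in>C. if x = c then v else 0)" by (intro sum.cong) auto
  also have "\<dots> = (if x \<in> C then v else 0)" using assms by (simp add: sum.delta')
  finally show ?thesis using 1 by simp
qed

lemma step_fun_of_polys:
  fixes G :: "real poly set"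
  assumes "finite G" "\<And>y y'. (\<And>p. p \<in> G \<Longrightarrow> sgn (poly p y) = sgn (poly p y')) \<Longrightarrow> s y = s y'"
  shows "step_fun {\<rho>. \<exists>p\<in>G. p \<noteq> 0 \<and> poly p \<rho> = 0} s"
proof (rule step_funI)
  let ?Z = "{\<rho>. \<exists>p\<in>G. p \<noteq> 0 \<and> poly p \<rho> = 0}"
  have "?Z = (\<Union>p\<in>{p\<in>G. p \<noteq> 0}. {\<rho>. poly p \<rho> = 0})" by auto
  then show "finite ?Z" using assms(1) by (auto intro: poly_roots_finite)
  fix y y' assume y: "\<And>z. z \<in> ?Z \<Longrightarrow> sgn (y - z) = sgn (y' - z)"
  show "s y = s y'"
  proof (rule assms(2))
    fix p assume p: "p \<in> G"
    show "sgn (poly p y) = sgn (poly p y')"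
    proof (cases "p = 0")
      case False
      then show ?thesis by (rule sgn_poly_same_position) (use y p False in blast)
    qed simp
  qed
qed

lemma monotone_or_constant_of_derivative:
  assumes J: "open J" "convex J" "x0 \<in> J"
    and d: "\<And>x. x \<in> J \<Longrightarrow> (r has_real_derivative d x) (at x)"
    and sgn: "\<And>x. x \<in> J \<Longrightarrow> sgn (d x) = sgn (d x0)"
  shows "monotone_or_constant_on J r"
proof -
  have iv: "z \<in> J" if "a \<in> J" "b \<in> J" "a \<le> z" "z \<le> b" for a b z
    using J(2) that unfolding is_interval_convex_1[symmetric] is_interval_1 by blast
  consider "d x0 > 0" | "d x0 < 0" | "d x0 = 0" by linarith
  then show ?thesis
  proof cases
    case 1
    then have pos: "d x > 0" if "x \<in> J" for x using sgn[OF that] by (metis sgn_greater)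
    have "r x < r y" if "x \<in> J" "y \<in> J" "x < y" for x y
      by (rule DERIV_pos_imp_increasing[OF that(3)]) (use d pos iv[OF that(1,2)] in blast)
    then show ?thesis unfolding monotone_or_constant_on_def by (auto simp: monotone_on_def)
  next
    case 2
    then have neg: "d x < 0" if "x \<in> J" for x using sgn[OF that] by (metis sgn_less)
    have "r x > r y" if "x \<in> J" "y \<in> J" "x < y" for x y
      by (rule DERIV_neg_imp_decreasing[OF that(3)]) (use d neg iv[OF that(1,2)] in blast)
    then show ?thesis unfolding monotone_or_constant_on_def by (auto simp: monotone_on_def)
  next
    case 3
    then have "d x = 0" if "x \<in> J" for x using sgn[OF that] by (simp add: sgn_0_0)
    then have "\<exists>c. \<forall>x\<in>J. r x = c"
      using has_field_derivative_zero_constant[OF J(2), of r] d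
      by (metis has_field_derivative_at_within)
    then show ?thesis unfolding monotone_or_constant_on_def by blast
  qed
qed

text \<open>In the coordinate supplied by \<open>\<phi> x\<close> the function no longer depends on
  \<open>x\<close>. A point generator of \<open>s\<close> at \<open>\<rho>\<close> becomes the graph
  of \<open>\<lambda>x. \<phi> x \<rho>\<close> over \<open>J\<close>, and a ray generator the
  region below that graph.\<close>

lemma fubini_on_strip:
  assumes J: "open J" "convex J"
    and step: "step_fun R s"
    and bij: "\<And>x. x \<in> J \<Longrightarrow> strict_mono (\<phi> x) \<and> surj (\<phi> x)"
    and h: "\<And>x y. x \<in> J \<Longrightarrow> h x (\<phi> x y) = s y"
    and cont: "\<And>\<rho>. \<rho> \<in> R \<Longrightarrow> continuous_on J (\<lambda>x. \<phi> x \<rho>)"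
    and mono: "\<And>\<rho>. \<rho> \<in> R \<Longrightarrow> monotone_or_constant_on J (\<lambda>x. \<phi> x \<rho>)"
  shows "fubini (\<lambda>x y. (if x \<in> J then 1 else 0) * h x y)"
proof -
  have inv: "inv (\<phi> x) (\<phi> x y) = y" "\<phi> x (inv (\<phi> x) y) = y" if "x \<in> J" for x y
    using bij[OF that] by (simp_all add: inv_f_f strict_mono_imp_inj_on surj_f_inv_f)
  have eq: "(\<lambda>x y. (if x \<in> J then 1 else 0) * h x y) = (\<lambda>x y. (if x \<in> J then 1 else 0) * s (inv (\<phi> x) y))"
    using h inv(2) by (auto simp: fun_eq_iff) metis
  have "fubini (\<lambda>x y. (if x \<in> J then 1 else 0) * s (inv (\<phi> x) y))"
    using step
  proof (induction rule: step_fun.induct)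
    case (const c)
    then show ?case
      by (rule fubini_prod[OF schanuel1_open_convex(1)[OF J] schanuel1_const(1)])
  next
    case (point \<rho>)
    have "(if x \<in> J then 1 else 0) * (if inv (\<phi> x) y = \<rho> then 1 else 0) =
      (if x \<in> J \<and> y = \<phi> x \<rho> then 1 else 0 :: real)" for x y
      using inv[of x] by auto
    then show ?case using fubini_graph[OF J cont[OF point] mono[OF point]] by presburger
  next
    case (ray \<rho>)
    have "inv (\<phi> x) y < \<rho> \<longleftrightarrow> y < \<phi> x \<rho>" if "x \<in> J" for x y
      using bij[OF that] inv(2)[OF that] by (metis strict_mono_less)
    then have "(if x \<in> J then 1 else 0) * (if inv (\<phi> x) y < \<rho> then 1 else 0) =
      (if x \<in> J \<and> y < \<phi> x \<rho> then 1 else 0 :: real)" for x y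
      by auto
    then show ?case using fubini_below[OF J cont[OF ray] mono[OF ray]] by presburger
  next
    case (add s t)
    show ?case using fubini_add[OF add.IH] by (simp add: distrib_left)
  next
    case (cmult s c)
    show ?case using fubini_cmult[OF cmult.IH, of c] by (simp add: mult.left_commute)
  qed
  then show ?thesis unfolding eq .
qed

theorem planar_fubini:
  fixes G :: "(real \<Rightarrow> real poly) set"
  assumes G: "finite G" "\<And>P. P \<in> G \<Longrightarrow> \<exists>d. param_poly P d"
    and h: "\<And>x y x' y'. (\<And>P. P \<in> G \<Longrightarrow> sgn (poly (P x) y) = sgn (poly (P x') y')) \<Longrightarrow> h x y = h x' y'"
  shows "fubini h"
proof -
  obtain D where D: "\<And>P. P \<in> G \<Longrightarrow> param_poly P (D P)" using G(2) by metis
  \<comment> \<open>With all derivatives present, every root of a nonzero member is a simple root of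
    some member whose derivative is a member too (\<open>root\<close>); branches can then be
    differentiated implicitly.\<close>
  define G0 where "G0 = (\<Union>P\<in>G. (\<lambda>k x. (pderiv ^^ k) (P x)) ` {..D P})"
  have G0fin: "finite G0" unfolding G0_def using G(1) by auto
  have G0p: "\<exists>d. param_poly P d" if "P \<in> G0" for P
    using that param_poly_higher_pderiv[OF D] unfolding G0_def by blast
  have in_G0: "(\<lambda>x. (pderiv ^^ k) (P x)) \<in> G0" if "P \<in> G" "k \<le> D P" for P k
    unfolding G0_def using that by (intro UN_I image_eqI[of _ _ k]) auto
  have GG0: "G \<subseteq> G0" using in_G0[of _ 0] by auto
  have root: "\<exists>P'\<in>G0. (\<lambda>x. pderiv (P' x)) \<in> G0 \<and> poly (P' x) \<rho> = 0 \<and> poly (pderiv (P' x)) \<rho> \<noteq> 0"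
    if P: "P \<in> G0" "P x \<noteq> 0" "poly (P x) \<rho> = 0" for P x \<rho>
  proof -
    obtain P0 k where P0: "P0 \<in> G" "P = (\<lambda>x. (pderiv ^^ k) (P0 x))" using P(1) unfolding G0_def by blast
    then obtain m where m: "m < degree (P0 x)" "poly ((pderiv ^^ m) (P0 x)) \<rho> = 0"
      "poly (pderiv ((pderiv ^^ m) (P0 x))) \<rho> \<noteq> 0"
      using higher_pderiv_root[of k "P0 x" \<rho>] P by auto
    have "Suc m \<le> D P0" using m(1) param_poly_degree[OF D[OF P0(1)], of x] by simp
    then have "(\<lambda>x. (pderiv ^^ m) (P0 x)) \<in> G0" "(\<lambda>x. pderiv ((pderiv ^^ m) (P0 x))) \<in> G0"
      using in_G0[OF P0(1), of m] in_G0[OF P0(1), of "Suc m"] by simp_all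
    then show ?thesis using m(2,3) by (intro bexI[of _ "\<lambda>x. (pderiv ^^ m) (P0 x)"] conjI)
  qed
  have "\<forall>P\<in>G0. \<exists>P'. (\<exists>d. param_poly P' d) \<and>
      (\<forall>x y. ((\<lambda>x. poly (P x) y) has_real_derivative poly (P' x) y) (at x))"
    using G0p param_poly_has_derivative by blast
  then obtain dx where dx: "\<And>P. P \<in> G0 \<Longrightarrow> \<exists>d. param_poly (dx P) d"
    "\<And>P x y. P \<in> G0 \<Longrightarrow> ((\<lambda>x. poly (P x) y) has_real_derivative poly (dx P x) y) (at x)" by metis
  \<comment> \<open>The derivatives in \<open>x\<close> join the elimination: with them both partial
    derivatives keep their signs along a root branch over a strip, and so does the slope of the
    branch.\<close>
  have "\<exists>Q. finite Q \<and> (\<forall>q\<in>Q. real_polynomial_function q) \<and>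
    (\<forall>a b. (\<forall>q\<in>Q. sgn (q a) = sgn (q b)) \<longrightarrow>
      (\<exists>\<phi>. strict_mono \<phi> \<and> surj \<phi> \<and> (\<forall>P\<in>G0 \<union> dx ` G0. \<forall>x. sgn (poly (P a) x) = sgn (poly (P b) (\<phi> x)))))"
    using G0fin G0p dx(1) by (intro sign_homeo_exists) auto
  then obtain Q where Q: "finite Q" "\<And>q. q \<in> Q \<Longrightarrow> real_polynomial_function q"
    "\<And>a b. (\<And>q. q \<in> Q \<Longrightarrow> sgn (q a) = sgn (q b)) \<Longrightarrow>
      \<exists>\<phi>. strict_mono \<phi> \<and> surj \<phi> \<and> (\<forall>P\<in>G0 \<union> dx ` G0. \<forall>x. sgn (poly (P a) x) = sgn (poly (P b) (\<phi> x)))"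
    by metis
  obtain pq where pq: "\<And>q. q \<in> Q \<Longrightarrow> q = poly (pq q)" using polynomial_function_real_imp_poly[OF Q(2)] by metis
  \<comment> \<open>On an interval that avoids \<open>C\<close> every member of \<open>Q\<close> has
    constant sign. Members that vanish identically are excluded to keep \<open>C\<close>
    finite.\<close>
  define C where "C = (\<Union>q\<in>{q\<in>Q. pq q \<noteq> 0}. {x. poly (pq q) x = 0})"
  have C: "finite C" unfolding C_def using Q(1) by (auto intro: poly_roots_finite)
  have step: "step_fun {\<rho>. \<exists>P\<in>G0. P x \<noteq> 0 \<and> poly (P x) \<rho> = 0} (h x)" for x
  proof -
    have "step_fun {\<rho>. \<exists>p\<in>(\<lambda>P. P x) ` G0. p \<noteq> 0 \<and> poly p \<rho> = 0} (h x)"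
    proof (rule step_fun_of_polys)
      show "finite ((\<lambda>P. P x) ` G0)" using G0fin by simp
      fix y y' assume "\<And>p. p \<in> (\<lambda>P. P x) ` G0 \<Longrightarrow> sgn (poly p y) = sgn (poly p y')"
      then show "h x y = h x y'" using GG0 by (intro h) blast
    qed
    moreover have "{\<rho>. \<exists>p\<in>(\<lambda>P. P x) ` G0. p \<noteq> 0 \<and> poly p \<rho> = 0} = {\<rho>. \<exists>P\<in>G0. P x \<noteq> 0 \<and> poly (P x) \<rho> = 0}"
      by blast
    ultimately show ?thesis by simp
  qed
  have strip: "fubini (\<lambda>x y. (if x \<in> J then 1 else 0) * h x y)"
    if J: "open J" "convex J" "J \<inter> C = {}" for J
  proof (cases "J = {}")
    case True
    then show ?thesis using fubini_zero by simp
  next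
    case False
    then obtain x0 where x0: "x0 \<in> J" by blast
    have iv: "z \<in> J" if "a \<in> J" "b \<in> J" "a \<le> z" "z \<le> b" for a b z
      using J(2) that unfolding is_interval_convex_1[symmetric] is_interval_1 by blast
    have sgnQ: "sgn (q x0) = sgn (q x)" if q: "q \<in> Q" and x: "x \<in> J" for q x
    proof (cases "pq q = 0")
      case True
      then show ?thesis using pq[OF q] by (metis poly_0)
    next
      case False
      have "sgn (poly (pq q) x0) = sgn (poly (pq q) x)"
      proof (rule sgn_poly_same_position[OF False])
        fix z assume "poly (pq q) z = 0"
        then have "z \<notin> J" using q False J(3) unfolding C_def by blast
        then have "z < x0 \<and> z < x \<or> x0 < z \<and> x < z"
          using iv[OF x0 x, of z] iv[OF x x0, of z] x x0 by (metis linorder_less_linear not_less)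
        then show "sgn (x0 - z) = sgn (x - z)" by auto
      qed
      then show ?thesis using pq[OF q] by metis
    qed
    have "\<exists>\<phi>. strict_mono \<phi> \<and> surj \<phi> \<and> (\<forall>P\<in>G0 \<union> dx ` G0. \<forall>y. sgn (poly (P x0) y) = sgn (poly (P x) (\<phi> y)))"
      if "x \<in> J" for x
      using Q(3)[of x0 x] sgnQ that by blast
    then obtain \<phi> where \<phi>: "\<And>x. x \<in> J \<Longrightarrow> strict_mono (\<phi> x)" "\<And>x. x \<in> J \<Longrightarrow> surj (\<phi> x)"
      "\<And>x P y. x \<in> J \<Longrightarrow> P \<in> G0 \<union> dx ` G0 \<Longrightarrow> sgn (poly (P x0) y) = sgn (poly (P x) (\<phi> x y))"
      by metis
    \<comment> \<open>The roots over the base point \<open>x0\<close> index the branches: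
      \<open>\<phi> x \<rho>\<close> is the point over \<open>x\<close> of the branch that belongs
      to \<open>\<rho>\<close>.\<close>
    define R where "R = {\<rho>. \<exists>P\<in>G0. P x0 \<noteq> 0 \<and> poly (P x0) \<rho> = 0}"
    have "R = (\<Union>P\<in>{P\<in>G0. P x0 \<noteq> 0}. {\<rho>. poly (P x0) \<rho> = 0})" unfolding R_def by auto
    then have Rfin: "finite R" using G0fin by (auto intro: poly_roots_finite)
    have "\<forall>\<rho>\<in>R. \<exists>P\<in>G0. (\<lambda>x. pderiv (P x)) \<in> G0 \<and> poly (P x0) \<rho> = 0 \<and> poly (pderiv (P x0)) \<rho> \<noteq> 0"
      using root unfolding R_def by blast
    then obtain p where p: "\<And>\<rho>. \<rho> \<in> R \<Longrightarrow> p \<rho> \<in> G0" "\<And>\<rho>. \<rho> \<in> R \<Longrightarrow> (\<lambda>x. pderiv (p \<rho> x)) \<in> G0"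
      "\<And>\<rho>. \<rho> \<in> R \<Longrightarrow> poly (p \<rho> x0) \<rho> = 0" "\<And>\<rho>. \<rho> \<in> R \<Longrightarrow> poly (pderiv (p \<rho> x0)) \<rho> \<noteq> 0"
      by metis
    have zero: "poly (p \<rho> x) (\<phi> x \<rho>) = 0" if "\<rho> \<in> R" "x \<in> J" for \<rho> x
      using \<phi>(3)[OF that(2), of "p \<rho>" \<rho>] p(1,3)[OF that(1)] by (simp add: sgn_0_0 eq_commute[of 0])
    have sgn_py: "sgn (poly (pderiv (p \<rho> x)) (\<phi> x \<rho>)) = sgn (poly (pderiv (p \<rho> x0)) \<rho>)"
      if "\<rho> \<in> R" "x \<in> J" for \<rho> x
      using \<phi>(3)[OF that(2), of "\<lambda>x. pderiv (p \<rho> x)" \<rho>] p(2)[OF that(1)] by simp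
    have sgn_px: "sgn (poly (dx (p \<rho>) x) (\<phi> x \<rho>)) = sgn (poly (dx (p \<rho>) x0) \<rho>)"
      if "\<rho> \<in> R" "x \<in> J" for \<rho> x
      using \<phi>(3)[OF that(2), of "dx (p \<rho>)" \<rho>] p(1)[OF that(1)] by simp
    have py_nz: "poly (pderiv (p \<rho> x)) (\<phi> x \<rho>) \<noteq> 0" if "\<rho> \<in> R" "x \<in> J" for \<rho> x
      using sgn_py[OF that] p(4)[OF that(1)] by (metis sgn_0_0)
    have root_R: "y \<in> \<phi> x ` R" if asm: "x \<in> J" "\<rho> \<in> R" "poly (p \<rho> x) y = 0" for x y \<rho>
    proof -
      obtain y' where y': "y = \<phi> x y'" using \<phi>(2)[OF asm(1)] by (metis surjD)
      then have "poly (p \<rho> x0) y' = 0"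
        using \<phi>(3)[OF asm(1), of "p \<rho>" y'] p(1)[OF asm(2)] asm(3) by (simp add: sgn_0_0)
      moreover have "p \<rho> x0 \<noteq> 0" using p(4)[OF asm(2)] by auto
      ultimately show ?thesis unfolding R_def using p(1)[OF asm(2)] y' by blast
    qed
    have cont: "isCont (\<lambda>x. \<phi> x \<rho>) x1" if "\<rho> \<in> R" "x1 \<in> J" for \<rho> x1
    proof (rule roots_continuous[where R = R and J = J and p = "\<lambda>\<rho> x. poly (p \<rho> x)" and
            D = "\<lambda>\<rho>. poly (pderiv (p \<rho> x1)) (\<phi> x1 \<rho>)"])
      show "isCont (\<lambda>x. poly (p \<rho> x) y) x1" if "\<rho> \<in> R" for \<rho> y
        using G0p[OF p(1)[OF that]] param_poly_isCont(2) by blast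
      show "(poly (p \<rho> x1) has_real_derivative poly (pderiv (p \<rho> x1)) (\<phi> x1 \<rho>)) (at (\<phi> x1 \<rho>))" for \<rho>
        by (rule poly_DERIV)
      show "continuous_on UNIV (poly (p \<rho> x))" for \<rho> x
        by (intro continuous_intros)
    qed (fact Rfin J(1) that \<phi>(1) root_R zero[OF _ that(2)] py_nz[OF _ that(2)])+
    have deriv: "((\<lambda>x. \<phi> x \<rho>) has_real_derivative
        - (poly (dx (p \<rho>) x) (\<phi> x \<rho>) / poly (pderiv (p \<rho> x)) (\<phi> x \<rho>))) (at x)"
      if "\<rho> \<in> R" "x \<in> J" for \<rho> x
    proof (rule implicit_derivative[where p = "\<lambda>x. poly (p \<rho> x)" and J = J and
            px = "\<lambda>x. poly (dx (p \<rho>) x)" and py = "\<lambda>x. poly (pderiv (p \<rho> x))"])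
      show "isCont (\<lambda>(x, y). poly (dx (p \<rho>) x) y) (x, \<phi> x \<rho>)"
        using dx(1)[OF p(1)[OF that(1)]] param_poly_isCont(1) by blast
      show "(poly (p \<rho> x) has_real_derivative poly (pderiv (p \<rho> x)) y) (at y)" for x y
        by (rule poly_DERIV)
      show "isCont (poly (pderiv (p \<rho> x))) (\<phi> x \<rho>)"
        by (intro continuous_intros)
    qed (fact J(1) that cont[OF that] zero[OF that(1)] py_nz[OF that] dx(2)[OF p(1)[OF that(1)]])+
    have mono: "monotone_or_constant_on J (\<lambda>x. \<phi> x \<rho>)" if "\<rho> \<in> R" for \<rho>
    proof (rule monotone_or_constant_of_derivative[OF J(1,2) x0 deriv[OF that]])
      fix x assume x: "x \<in> J"
      show "sgn (- (poly (dx (p \<rho>) x) (\<phi> x \<rho>) / poly (pderiv (p \<rho> x)) (\<phi> x \<rho>))) =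
        sgn (- (poly (dx (p \<rho>) x0) (\<phi> x0 \<rho>) / poly (pderiv (p \<rho> x0)) (\<phi> x0 \<rho>)))"
        using sgn_px[OF that x] sgn_px[OF that x0] sgn_py[OF that x] sgn_py[OF that x0]
        by (simp add: sgn_minus sgn_divide)
    qed
    show ?thesis
    proof (rule fubini_on_strip[OF J(1,2) step[of x0, folded R_def], of \<phi>])
      show "h x (\<phi> x y) = h x0 y" if "x \<in> J" for x y
        using \<phi>(3)[OF that, symmetric] GG0 by (intro h) blast
      show "continuous_on J (\<lambda>x. \<phi> x \<rho>)" if "\<rho> \<in> R" for \<rho>
        using cont[OF that] by (simp add: continuous_at_imp_continuous_on)
    qed (use \<phi>(1,2) mono in auto)
  qed
  have point: "fubini (\<lambda>x y. (if x = c then 1 else 0) * h x y)" for c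
  proof -
    have eq: "(\<lambda>x y. (if x = c then 1 else 0) * h x y) = (\<lambda>x y. (if x = c then 1 else 0) * h c y)"
      by (auto simp: fun_eq_iff)
    show ?thesis unfolding eq by (rule fubini_prod[OF schanuel1_point(1) step_fun_integrable[OF step]])
  qed
  have "fubini (\<lambda>x y. (\<Sum>c\<in>C. (if x = c then 1 else 0) * h x y) +
      (\<Sum>B\<in>Pow C. (if x \<in> cell C B then 1 else 0) * h x y))"
  proof (intro fubini_add fubini_sum point strip)
    fix B assume "B \<in> Pow C"
    then show "open (cell C B)" "convex (cell C B)" "cell C B \<inter> C = {}"
      using cell_open_convex[OF C, of B] mem_cell_iff[of B C] by auto
  qed
  then show ?thesis by (simp only: sum_over_cells[OF C, symmetric])
qed

section \<open>Sign-determined functions and invariance under linear maps\<close>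

text \<open>The codomain is arbitrary so that membership predicates are covered along with real
  functions; for these, Boolean operations are instances of
  \<open>sign_determined_combine\<close>.\<close>

definition sign_determined :: "(real ^ 'n \<Rightarrow> 'b) \<Rightarrow> bool" where
  "sign_determined f \<longleftrightarrow> (\<exists>Q. finite Q \<and> (\<forall>q\<in>Q. real_polynomial_function q) \<and>
    (\<forall>a b. (\<forall>q\<in>Q. sgn (q a) = sgn (q b)) \<longrightarrow> f a = f b))"

lemma sign_determined_sgn:
  assumes "real_polynomial_function p" shows "sign_determined (\<lambda>a. F (sgn (p a)))"
  unfolding sign_determined_def using assms by (intro exI[of _ "{p}"]) auto

lemma sign_determined_combine:
  assumes "sign_determined f" "sign_determined g" shows "sign_determined (\<lambda>a. F (f a) (g a))"
proof -
  obtain Q where Q: "finite Q" "\<forall>q\<in>Q. real_polynomial_function q"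
    "\<forall>a b. (\<forall>q\<in>Q. sgn (q a) = sgn (q b)) \<longrightarrow> f a = f b"
    using assms(1) unfolding sign_determined_def by blast
  obtain R where R: "finite R" "\<forall>q\<in>R. real_polynomial_function q"
    "\<forall>a b. (\<forall>q\<in>R. sgn (q a) = sgn (q b)) \<longrightarrow> g a = g b"
    using assms(2) unfolding sign_determined_def by blast
  have "F (f a) (g a) = F (f b) (g b)" if "\<forall>q\<in>Q \<union> R. sgn (q a) = sgn (q b)" for a b
  proof -
    have "f a = f b" using Q(3) that by blast
    moreover have "g a = g b" using R(3) that by blast
    ultimately show ?thesis by simp
  qed
  then show ?thesis
    unfolding sign_determined_def using Q(1,2) R(1,2) by (intro exI[of _ "Q \<union> R"]) blast
qed

lemma sign_determined_indicator:
  assumes "semialgebraic A" shows "sign_determined (indicator A :: _ \<Rightarrow> real)"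
proof -
  have "sign_determined (\<lambda>a. a \<in> A)"
    using assms
  proof (induction rule: semialgebraic.induct)
    case (zero p)
    then show ?case using sign_determined_sgn[of p "\<lambda>s. s = 0"] by (simp add: sgn_0_0)
  next
    case (pos p)
    then show ?case using sign_determined_sgn[of p "\<lambda>s. s > 0"] by simp
  next
    case (Un A B)
    then show ?case using sign_determined_combine[OF Un.IH, of "(\<or>)"] by simp
  next
    case (Int A B)
    then show ?case using sign_determined_combine[OF Int.IH, of "(\<and>)"] by simp
  next
    case (Compl A)
    then show ?case using sign_determined_combine[OF Compl.IH Compl.IH, of "\<lambda>p q. \<not> p"] by simp
  qed
  from sign_determined_combine[OF this this, of "\<lambda>p q. of_bool p"]
  have "sign_determined (\<lambda>a. of_bool (a \<in> A) :: real)" .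
  moreover have "indicator A = (\<lambda>a. of_bool (a \<in> A) :: real)" by (auto simp: fun_eq_iff indicator_def)
  ultimately show ?thesis by simp
qed

lemma sign_determined_linear:
  assumes "sign_determined f" "linear T" shows "sign_determined (f \<circ> T)"
proof -
  obtain Q where Q: "finite Q" "\<And>q. q \<in> Q \<Longrightarrow> real_polynomial_function q"
    "\<And>a b. (\<And>q. q \<in> Q \<Longrightarrow> sgn (q a) = sgn (q b)) \<Longrightarrow> f a = f b"
    using assms(1) unfolding sign_determined_def by metis
  have "polynomial_function T"
    using assms(2) by (simp add: polynomial_function_bounded_linear linear_conv_bounded_linear)
  then have "real_polynomial_function (q \<circ> T)" if "q \<in> Q" for q
    using Q(2)[OF that] by (rule real_polynomial_function_compose)
  then show ?thesis
    unfolding sign_determined_def using Q(1)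
    by (intro exI[of _ "(\<lambda>q. q \<circ> T) ` Q"]) (auto intro!: Q(3))
qed

section \<open>Sections and integrals along a single coordinate\<close>

definition upd :: "'n \<Rightarrow> real ^ 'n \<Rightarrow> real \<Rightarrow> real ^ 'n" where
  "upd i a x = (\<chi> j. if j = i then x else a $ j)"

lemma upd_nth: "upd i a x $ j = (if j = i then x else a $ j)"
  by (simp add: upd_def)

lemma upd_commute: "i \<noteq> j \<Longrightarrow> upd i (upd j a y) x = upd j (upd i a x) y"
  by (simp add: vec_eq_iff upd_nth)

lemma upd_eq: "upd i a x = a + (x - a $ i) *\<^sub>R axis i 1"
  by (simp add: vec_eq_iff upd_nth axis_def)

lemma param_poly_add:
  assumes "param_poly P d" "param_poly Q e" shows "param_poly (\<lambda>a. P a + Q a) (max d e)"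
  using assms unfolding param_poly_def
  by (auto intro!: degree_add_le intro: le_max_iff_disj[THEN iffD2] real_polynomial_function.intros(3))

lemma param_poly_mult:
  assumes "param_poly P d" "param_poly Q e" shows "param_poly (\<lambda>a. P a * Q a) (d + e)"
  unfolding param_poly_def coeff_mult
proof (intro conjI allI real_polynomial_function_sum real_polynomial_function.intros(4))
  show "degree (P a * Q a) \<le> d + e" for a
    using degree_mult_le[of "P a" "Q a"] param_poly_degree[OF assms(1), of a] param_poly_degree[OF assms(2), of a]
    by linarith
qed (auto intro: assms[THEN param_poly_coeff])

text \<open>\<open>upd i a x\<close> runs along the axis of \<open>i\<close>, so a linear form
  becomes a polynomial of degree at most 1 in \<open>x\<close>, with slope
  \<open>h (axis i 1)\<close>; sums and products follow.\<close>

lemma polynomial_section: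
  assumes "real_polynomial_function (p :: real ^ 'n \<Rightarrow> real)"
  shows "\<exists>P d. param_poly P d \<and> (\<forall>a x. p (upd i a x) = poly (P a) x)"
  using assms
proof (induction rule: real_polynomial_function.induct)
  case (linear h)
  let ?P = "\<lambda>a. [:h a - a $ i * h (axis i 1), h (axis i 1):]"
  have "real_polynomial_function (\<lambda>a. coeff (?P a) j)" for j
  proof -
    have 0: "real_polynomial_function (\<lambda>a. h a - a $ i * h (axis i 1))"
      by (intro real_polynomial_function_diff real_polynomial_function.intros linear bounded_linear_vec_nth)
    show ?thesis
      using 0 real_polynomial_function.intros(2)
      by (cases j rule: nat.exhaust[case_product nat.exhaust]) (auto simp: coeff_pCons split: nat.splits)
  qed
  then have "param_poly ?P 1" unfolding param_poly_def by (auto simp: degree_pCons_le)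
  moreover have "h (upd i a x) = poly (?P a) x" for a x
    using linear.hyps by (simp add: upd_eq linear_simps algebra_simps)
  ultimately show ?case by blast
next
  case (const c)
  have "param_poly (\<lambda>_. [:c:]) 0"
    by (simp add: param_poly_def real_polynomial_function.intros(2))
  then show ?case by (intro exI[of _ "\<lambda>_. [:c:]"] exI[of _ 0]) simp
next
  case (add p q)
  then obtain P d Q e where "param_poly P d" "\<forall>a x. p (upd i a x) = poly (P a) x"
    "param_poly Q e" "\<forall>a x. q (upd i a x) = poly (Q a) x" by blast
  then show ?case using param_poly_add[of P d Q e] by (intro exI[of _ "\<lambda>a. P a + Q a"] exI[of _ "max d e"]) simp
next
  case (mult p q)
  then obtain P d Q e where "param_poly P d" "\<forall>a x. p (upd i a x) = poly (P a) x"
    "param_poly Q e" "\<forall>a x. q (upd i a x) = poly (Q a) x" by blast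
  then show ?case using param_poly_mult[of P d Q e] by (intro exI[of _ "\<lambda>a. P a * Q a"] exI[of _ "d + e"]) simp
qed

lemma sign_determined_sections:
  assumes "sign_determined f"
  shows "\<exists>G. finite G \<and> (\<forall>P\<in>G. \<exists>d. param_poly P d) \<and>
    (\<forall>a b x y. (\<forall>P\<in>G. sgn (poly (P a) x) = sgn (poly (P b) y)) \<longrightarrow> f (upd i a x) = f (upd i b y))"
proof -
  obtain Q where Q: "finite Q" "\<And>q. q \<in> Q \<Longrightarrow> real_polynomial_function q"
    "\<And>a b. (\<And>q. q \<in> Q \<Longrightarrow> sgn (q a) = sgn (q b)) \<Longrightarrow> f a = f b"
    using assms unfolding sign_determined_def by metis
  have "\<forall>q\<in>Q. \<exists>P. (\<exists>d. param_poly P d) \<and> (\<forall>a x. q (upd i a x) = poly (P a) x)"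
    using polynomial_section[OF Q(2)] by blast
  then obtain P where P: "\<And>q. q \<in> Q \<Longrightarrow> \<exists>d. param_poly (P q) d"
    "\<And>q a x. q \<in> Q \<Longrightarrow> q (upd i a x) = poly (P q a) x" by metis
  have "f (upd i a x) = f (upd i b y)"
    if "\<forall>R\<in>P ` Q. sgn (poly (R a) x) = sgn (poly (R b) y)" for a b x y
    by (rule Q(3)) (use that P(2) in auto)
  then show ?thesis using Q(1) P(1) by (intro exI[of _ "P ` Q"]) auto
qed

lemma sign_determined_step:
  assumes "sign_determined f" shows "\<exists>Z. step_fun Z (\<lambda>x. f (upd i a x))"
proof -
  obtain G where G: "finite G"
    "\<And>b c x y. (\<And>P. P \<in> G \<Longrightarrow> sgn (poly (P b) x) = sgn (poly (P c) y)) \<Longrightarrow> f (upd i b x) = f (upd i c y)"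
    using sign_determined_sections[OF assms, of i] by metis
  have "step_fun {\<rho>. \<exists>p\<in>(\<lambda>P. P a) ` G. p \<noteq> 0 \<and> poly p \<rho> = 0} (\<lambda>x. f (upd i a x))"
  proof (rule step_fun_of_polys)
    fix y y' assume "\<And>p. p \<in> (\<lambda>P. P a) ` G \<Longrightarrow> sgn (poly p y) = sgn (poly p y')"
    then show "f (upd i a y) = f (upd i a y')" by (intro G(2)) blast
  qed (use G(1) in simp)
  then show ?thesis by blast
qed

text \<open>The result lives on the full space again and merely ignores coordinate \<open>i\<close>.
  So integrals over different coordinates can be composed and interchanged without changing the
  space.\<close>

definition integrate_coord :: "'n \<Rightarrow> (real ^ 'n \<Rightarrow> real) \<Rightarrow> real ^ 'n \<Rightarrow> real" where
  "integrate_coord i f a = schanuel_integral1 (\<lambda>x. f (upd i a x))"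

lemma integrate_coord_reparam:
  assumes "sign_determined f" "bij \<phi>" "continuous_on UNIV \<phi>"
  shows "schanuel_integral1 (\<lambda>x. f (upd i a (\<phi> x))) = integrate_coord i f a"
  using sign_determined_step[OF assms(1), of i a] schanuel1_step_comp[OF _ assms(2,3)]
  unfolding integrate_coord_def by blast

lemma sign_determined_integrate:
  assumes "sign_determined f" shows "sign_determined (integrate_coord i f)"
proof -
  obtain G where G: "finite G" "\<And>P. P \<in> G \<Longrightarrow> \<exists>d. param_poly P d"
    "\<And>a b x y. (\<And>P. P \<in> G \<Longrightarrow> sgn (poly (P a) x) = sgn (poly (P b) y)) \<Longrightarrow> f (upd i a x) = f (upd i b y)"
    using sign_determined_sections[OF assms, of i] by metis
  obtain Q where Q: "finite Q" "\<forall>q\<in>Q. real_polynomial_function q"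
    "\<forall>a b. (\<forall>q\<in>Q. sgn (q a) = sgn (q b)) \<longrightarrow>
      (\<exists>\<phi>. strict_mono \<phi> \<and> surj \<phi> \<and> (\<forall>P\<in>G. \<forall>x. sgn (poly (P a) x) = sgn (poly (P b) (\<phi> x))))"
    using sign_homeo_exists[OF G(1,2)] by blast
  have "integrate_coord i f a = integrate_coord i f b" if ab: "\<forall>q\<in>Q. sgn (q a) = sgn (q b)" for a b
  proof -
    obtain \<phi> where \<phi>: "strict_mono \<phi>" "surj \<phi>"
      "\<forall>P\<in>G. \<forall>x. sgn (poly (P a) x) = sgn (poly (P b) (\<phi> x))"
      using Q(3) ab by blast
    have "f (upd i a x) = f (upd i b (\<phi> x))" for x
      by (rule G(3)) (use \<phi>(3) in blast)
    then have "integrate_coord i f a = schanuel_integral1 (\<lambda>x. f (upd i b (\<phi> x)))"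
      by (simp add: integrate_coord_def)
    also have "\<dots> = integrate_coord i f b"
      using \<phi>(1,2) by (intro integrate_coord_reparam assms strict_mono_surj_isCont)
        (auto simp: bij_def strict_mono_imp_inj_on)
    finally show ?thesis .
  qed
  then show ?thesis unfolding sign_determined_def using Q(1,2) by blast
qed

lemma integrate_coord_commute:
  assumes "sign_determined f"
  shows "integrate_coord i (integrate_coord j f) = integrate_coord j (integrate_coord i f)"
proof (cases "i = j")
  case False
  obtain G where G: "finite G" "\<And>P. P \<in> G \<Longrightarrow> \<exists>d. param_poly P d"
    "\<And>a b x y. (\<And>P. P \<in> G \<Longrightarrow> sgn (poly (P a) x) = sgn (poly (P b) y)) \<Longrightarrow> f (upd j a x) = f (upd j b y)"
    using sign_determined_sections[OF assms, of j] by metis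
  show ?thesis
  proof
    fix a
    have lin: "polynomial_function (\<lambda>x. upd i a x)"
      unfolding upd_eq scaleR_left_diff_distrib
      by (intro polynomial_function_add polynomial_function_diff polynomial_function_const
          polynomial_function_bounded_linear bounded_linear_scaleR_left)
    \<comment> \<open>With the other coordinates frozen, the vector parameter of \<open>G\<close>
      shrinks to the single real \<open>x\<close>; since \<open>upd i a\<close> is a polynomial map,
      the coefficients stay polynomial.\<close>
    have "fubini (\<lambda>x y. f (upd j (upd i a x) y))"
    proof (rule planar_fubini[where G = "(\<lambda>P x. P (upd i a x)) ` G"])
      fix P assume "P \<in> (\<lambda>P x. P (upd i a x)) ` G"
      then obtain R d where R: "P = (\<lambda>x. R (upd i a x))" "param_poly R d" using G(2) by blast
      have "real_polynomial_function (\<lambda>x. coeff (R (upd i a x)) k)" for k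
        using real_polynomial_function_compose[OF lin param_poly_coeff[OF R(2)]] by (simp add: comp_def)
      then have "param_poly P d" using param_poly_degree[OF R(2)] unfolding R(1) param_poly_def by simp
      then show "\<exists>d. param_poly P d" ..
    next
      fix x y x' y'
      assume "\<And>P. P \<in> (\<lambda>P x. P (upd i a x)) ` G \<Longrightarrow> sgn (poly (P x) y) = sgn (poly (P x') y')"
      then show "f (upd j (upd i a x) y) = f (upd j (upd i a x') y')" by (intro G(3)) blast
    qed (use G(1) in simp)
    then have "schanuel_integral1 (\<lambda>x. schanuel_integral1 (\<lambda>y. f (upd j (upd i a x) y))) =
        schanuel_integral1 (\<lambda>y. schanuel_integral1 (\<lambda>x. f (upd j (upd i a x) y)))"
      unfolding fubini_def by blast
    then show "integrate_coord i (integrate_coord j f) a = integrate_coord j (integrate_coord i f) a"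
      unfolding integrate_coord_def by (simp add: upd_commute[OF False])
  qed
qed simp

section \<open>Iterated coordinate integrals under linear maps\<close>

abbreviation integrate_coords :: "'n list \<Rightarrow> (real ^ 'n \<Rightarrow> real) \<Rightarrow> real ^ 'n \<Rightarrow> real" where
  "integrate_coords is f \<equiv> foldr integrate_coord is f"

lemma sign_determined_integrate_coords:
  "sign_determined f \<Longrightarrow> sign_determined (integrate_coords is f)"
  by (induction "is") (simp_all add: sign_determined_integrate)

lemma integrate_coords_move:
  assumes "sign_determined f"
  shows "integrate_coords (is @ i # js) f = integrate_coord i (integrate_coords (is @ js) f)"
proof (induction "is")
  case (Cons k "is")
  then show ?case
    using integrate_coord_commute[OF sign_determined_integrate_coords[OF assms, of "is @ js"]] by simp
qed simp

lemma integrate_coords_permute: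
  assumes "sign_determined f" "mset is = mset js"
  shows "integrate_coords is f = integrate_coords js f"
  using assms(2)
proof (induction "is" arbitrary: js)
  case (Cons i "is")
  have "i \<in> set js" using Cons.prems by (metis list.set_intros(1) mset_eq_setD)
  then obtain ks ls where js: "js = ks @ i # ls" by (meson split_list)
  then have "mset is = mset (ks @ ls)" using Cons.prems by simp
  then show ?case using Cons.IH[of "ks @ ls"] unfolding js integrate_coords_move[OF assms(1)] by simp
qed simp

lemma integrate_coords_cong_outside:
  assumes "\<And>i. i \<notin> set is \<Longrightarrow> a $ i = b $ i"
  shows "integrate_coords is f a = integrate_coords is f b"
  using assms
proof (induction "is" arbitrary: a b)
  case Nil
  then have "a = b" by (simp add: vec_eq_iff)
  then show ?case by simp
next
  case (Cons k "is")
  have "integrate_coords is f (upd k a x) = integrate_coords is f (upd k b x)" for x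
    by (rule Cons.IH) (use Cons.prems in \<open>auto simp: upd_nth\<close>)
  then show ?case by (simp add: integrate_coord_def[of k])
qed

text \<open>Along coordinate \<open>k\<close> the map is multiplication by \<open>c k\<close>, a
  homeomorphism of the line, order-reversing for negative \<open>c k\<close>. \<open>T\<close>
  remains on the right-hand side because the coordinates outside \<open>is\<close> are still scaled;
  once all are integrated out it has no effect.\<close>

lemma integrate_coords_scale:
  fixes c :: "'n::finite \<Rightarrow> real"
  assumes f: "sign_determined f" and c: "\<And>i. c i \<noteq> 0"
  defines "T \<equiv> (\<lambda>x. \<chi> i. c i * x $ i)"
  shows "integrate_coords is (f \<circ> T) = integrate_coords is f \<circ> T"
proof (induction "is")
  case (Cons k "is")
  have "integrate_coord k (integrate_coords is f \<circ> T) a = integrate_coord k (integrate_coords is f) (T a)" for a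
  proof -
    have "T (upd k a x) = upd k (T a) (c k * x)" for x
      by (simp add: T_def vec_eq_iff upd_nth)
    then have "integrate_coord k (integrate_coords is f \<circ> T) a =
        schanuel_integral1 (\<lambda>x. integrate_coords is f (upd k (T a) (c k * x)))"
      by (simp add: integrate_coord_def)
    also have "\<dots> = integrate_coord k (integrate_coords is f) (T a)"
    proof (rule integrate_coord_reparam[OF sign_determined_integrate_coords[OF f]])
      show "bij ((*) (c k))"
        using c[of k] by (intro o_bij[of "\<lambda>x. x / c k"]) (auto simp: fun_eq_iff)
    qed (intro continuous_intros)
    finally show ?thesis .
  qed
  then have "integrate_coord k (integrate_coords is f \<circ> T) = integrate_coord k (integrate_coords is f) \<circ> T"
    by (simp add: fun_eq_iff)
  moreover have "integrate_coords (k # is) (f \<circ> T) = integrate_coord k (integrate_coords is f \<circ> T)"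
    using Cons.IH by (simp add: comp_def)
  ultimately show ?case by (simp add: comp_def)
qed simp

lemma integrate_coord_shear:
  assumes f: "sign_determined f" and "m \<noteq> n"
  shows "integrate_coord m (f \<circ> (\<lambda>x. \<chi> i. if i = m then x $ m + x $ n else x $ i)) = integrate_coord m f"
proof
  fix a
  have "(\<chi> i. if i = m then upd m a x $ m + upd m a x $ n else upd m a x $ i) = upd m a (x + a $ n)" for x
    using assms(2) by (simp add: vec_eq_iff upd_nth)
  then have "integrate_coord m (f \<circ> (\<lambda>x. \<chi> i. if i = m then x $ m + x $ n else x $ i)) a =
      schanuel_integral1 (\<lambda>x. f (upd m a (x + a $ n)))"
    by (simp add: integrate_coord_def)
  also have "\<dots> = integrate_coord m f a"
  proof (rule integrate_coord_reparam[OF f])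
    show "bij (\<lambda>x. x + a $ n)"
      by (intro o_bij[of "\<lambda>x. x - a $ n"]) (auto simp: fun_eq_iff)
  qed (intro continuous_intros)
  finally show "integrate_coord m (f \<circ> (\<lambda>x. \<chi> i. if i = m then x $ m + x $ n else x $ i)) a = integrate_coord m f a" .
qed

lemma integrate_coord_swap:
  assumes f: "sign_determined f" and "m \<noteq> n"
  shows "integrate_coord m (integrate_coord n (f \<circ> (\<lambda>x. \<chi> i. x $ Transposition.transpose m n i))) =
    integrate_coord m (integrate_coord n f)"
proof -
  have "(\<chi> i. upd n (upd m a x) y $ Transposition.transpose m n i) = upd m (upd n a x) y" for a x y
    using assms(2) by (simp add: vec_eq_iff upd_nth Transposition.transpose_def)
  then have "integrate_coord m (integrate_coord n (f \<circ> (\<lambda>x. \<chi> i. x $ Transposition.transpose m n i))) a =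
      integrate_coord n (integrate_coord m f) a" for a
    unfolding integrate_coord_def comp_apply by presburger
  then have "integrate_coord m (integrate_coord n (f \<circ> (\<lambda>x. \<chi> i. x $ Transposition.transpose m n i))) =
      integrate_coord n (integrate_coord m f)"
    by (rule ext)
  then show ?thesis using integrate_coord_commute[OF f] by simp
qed

lemma integrate_all_linear_invariant:
  fixes T :: "real ^ 'n \<Rightarrow> real ^ 'n"
  assumes "linear T" and es: "distinct es" "set es = UNIV" and "inj T" and f: "sign_determined f"
  shows "integrate_coords es (f \<circ> T) a = integrate_coords es f a"
proof -
  \<comment> \<open>The induction over elementary maps runs through all linear maps, so injectivity
    is made part of the predicate; maps with a vanishing coordinate then satisfy it vacuously.
    \<open>f\<close> is quantified inside because a composition \<open>S \<circ> T\<close> uses the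
    claim for \<open>T\<close> at \<open>f \<circ> S\<close>.\<close>
  let ?P = "\<lambda>T. inj T \<longrightarrow> (\<forall>f a. sign_determined f \<longrightarrow> integrate_coords es (f \<circ> T) a = integrate_coords es f a)"
  have split1: "integrate_coords es g = integrate_coords (remove1 m es) (integrate_coord m g)"
    if "sign_determined g" for m g
  proof -
    have "mset es = mset (remove1 m es @ [m])" using es by simp
    from integrate_coords_permute[OF that this] show ?thesis by simp
  qed
  have split2: "integrate_coords es g =
      integrate_coords (remove1 n (remove1 m es)) (integrate_coord m (integrate_coord n g))"
    if "sign_determined g" "m \<noteq> n" for m n g
  proof -
    define ks where "ks = remove1 m es"
    define ls where "ls = remove1 n ks"
    have 1: "mset es = add_mset m (mset ks)" using es by (simp add: ks_def)
    have "n \<in> set ks" using es that(2) by (simp add: ks_def)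
    then have 2: "mset ks = add_mset n (mset ls)" by (simp add: ls_def)
    have "mset es = mset (ls @ [m, n])" by (simp add: 1 2)
    from integrate_coords_permute[OF that(1) this]
    show ?thesis by (simp add: ls_def ks_def)
  qed
  have "?P T"
    using assms(1)
  proof (rule induct_linear_elementary)
    fix S T :: "real ^ 'n \<Rightarrow> real ^ 'n" assume *: "linear S" "linear T" "?P S" "?P T"
    show "?P (S \<circ> T)"
    proof (intro impI allI)
      fix f :: "real ^ 'n \<Rightarrow> real" and a assume inj: "inj (S \<circ> T)" and f: "sign_determined f"
      have T: "inj T" using inj by (rule inj_on_imageI2)
      \<comment> \<open>Injectivity of \<open>S \<circ> T\<close> gives that of \<open>S\<close>
        only on the range of \<open>T\<close>; equality of dimensions makes this range
        everything.\<close>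
      then have "surj T" using *(2) by (simp add: linear_injective_imp_surjective)
      then have S: "inj S" using inj by (metis comp_inj_on_iff inj_on_imageI)
      have "integrate_coords es (f \<circ> S \<circ> T) a = integrate_coords es f a"
        using *(3,4) S T f sign_determined_linear[OF f *(1)] by metis
      then show "integrate_coords es (f \<circ> (S \<circ> T)) a = integrate_coords es f a" by (simp add: comp_assoc)
    qed
  next
    fix T :: "real ^ 'n \<Rightarrow> real ^ 'n" and i assume *: "linear T" "\<And>x. T x $ i = 0"
    have "\<not> surj T"
    proof
      assume "surj T"
      then obtain x where "T x = axis i 1" by (metis surjD)
      then show False using *(2)[of x] by (simp add: axis_def)
    qed
    then show "?P T" using *(1) linear_injective_imp_surjective by blast
  next
    fix c :: "'n \<Rightarrow> real"
    let ?T = "\<lambda>x. \<chi> i. c i * x $ i"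
    show "?P ?T"
    proof (intro impI allI)
      fix f :: "real ^ 'n \<Rightarrow> real" and a assume inj: "inj ?T" and f: "sign_determined f"
      have "c i \<noteq> 0" for i
      proof
        assume "c i = 0"
        then have "?T (axis i 1) = ?T 0" by (simp add: vec_eq_iff axis_def)
        then show False using inj by (metis axis_eq_0_iff injD zero_neq_one)
      qed
      from integrate_coords_scale[OF f this]
      have "integrate_coords es (f \<circ> ?T) a = integrate_coords es f (?T a)" by (simp add: fun_eq_iff)
      also have "\<dots> = integrate_coords es f a" by (rule integrate_coords_cong_outside) (simp add: es)
      finally show "integrate_coords es (f \<circ> ?T) a = integrate_coords es f a" .
    qed
  next
    fix m n :: 'n assume mn: "m \<noteq> n"
    let ?T = "\<lambda>x::real ^ 'n. \<chi> i. x $ Transposition.transpose m n i"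
    have lin: "linear ?T" by (intro linearI) (simp_all add: vec_eq_iff)
    show "?P ?T"
    proof (intro impI allI)
      fix f :: "real ^ 'n \<Rightarrow> real" and a assume f: "sign_determined f"
      show "integrate_coords es (f \<circ> ?T) a = integrate_coords es f a"
        unfolding split2[OF sign_determined_linear[OF f lin] mn] split2[OF f mn] integrate_coord_swap[OF f mn] ..
    qed
  next
    fix m n :: 'n assume mn: "m \<noteq> n"
    let ?T = "\<lambda>x::real ^ 'n. \<chi> i. if i = m then x $ m + x $ n else x $ i"
    have lin: "linear ?T" by (intro linearI) (auto simp: vec_eq_iff algebra_simps)
    show "?P ?T"
    proof (intro impI allI)
      fix f :: "real ^ 'n \<Rightarrow> real" and a assume f: "sign_determined f"
      show "integrate_coords es (f \<circ> ?T) a = integrate_coords es f a"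
        unfolding split1[OF sign_determined_linear[OF f lin], of m] split1[OF f, of m] integrate_coord_shear[OF f mn] ..
    qed
  qed
  then show ?thesis using assms by blast
qed

section \<open>From coordinate lists to vectors\<close>

definition vec_of_list :: "'n list \<Rightarrow> real list \<Rightarrow> real ^ 'n" where
  "vec_of_list es as = fold (\<lambda>(i, x) a. upd i a x) (zip es as) 0"

text \<open>Coordinates without an entry are 0, so a list shorter than \<open>es\<close> denotes a
  point of the full space too. Appending an entry is then one \<open>upd\<close>, which makes one
  step of \<open>schanuel_iterate\<close> an instance of \<open>integrate_coord\<close>.\<close>

lemma vec_of_list_snoc:
  assumes "length as < length es"
  shows "vec_of_list es (as @ [x]) = upd (es ! length as) (vec_of_list es as) x"
proof -
  have "zip es (as @ [x]) = zip es as @ zip (drop (length as) es) [x]"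
    using zip_append2[of es as "[]"] by (simp add: zip_append2)
  also have "drop (length as) es = es ! length as # drop (Suc (length as)) es"
    using assms by (simp add: Cons_nth_drop_Suc)
  finally show ?thesis by (simp add: vec_of_list_def)
qed

lemma vec_of_list_nth:
  assumes "distinct es" "length as \<le> length es" "k < length as"
  shows "vec_of_list es as $ (es ! k) = as ! k"
  using assms(2,3)
proof (induction as rule: rev_induct)
  case (snoc x as)
  have "es ! k = es ! length as \<longleftrightarrow> k = length as"
    using assms(1) snoc.prems by (simp add: nth_eq_iff_index_eq)
  then show ?case
    using snoc by (auto simp: vec_of_list_snoc upd_nth nth_append)
qed simp

text \<open>Both recursions integrate out the last coordinate first. After \<open>j\<close> steps
  the list holds the first \<open>length es - j\<close> coordinates, and those in
  \<open>drop (length es - j) es\<close> are gone. The hypothesis speaks of full lists only, since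
  \<open>g\<close> is evaluated on no others.\<close>

lemma schanuel_iterate_eq_integrate_coords:
  assumes g: "\<And>as. length as = length es \<Longrightarrow> g as = f (vec_of_list es as)"
    and "j \<le> length es" "length as = length es - j"
  shows "schanuel_iterate j g as = integrate_coords (drop (length es - j) es) f (vec_of_list es as)"
  using assms(2,3)
proof (induction j arbitrary: as)
  case 0
  then show ?case by (simp add: g)
next
  case (Suc j)
  let ?k = "length es - Suc j"
  have k: "?k < length es" "Suc ?k = length es - j" using Suc.prems by auto
  have "schanuel_iterate j g (as @ [x]) =
      integrate_coords (drop (length es - j) es) f (upd (es ! ?k) (vec_of_list es as) x)" for x
    using Suc k by (simp add: vec_of_list_snoc)
  moreover have "drop ?k es = es ! ?k # drop (length es - j) es"
    using Cons_nth_drop_Suc[OF k(1)] k(2) by simp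
  ultimately show ?case by (simp add: integrate_coord_def[of "es ! ?k"])
qed

text \<open>The index type \<open>'n\<close> carries no order, so \<open>es\<close> numbers the
  coordinates. This is \<open>basis_map\<close> turned into an endomorphism of the space, to which
  the invariance under linear maps applies.\<close>

definition basis_transform :: "'n list \<Rightarrow> (real ^ 'n) list \<Rightarrow> real ^ 'n \<Rightarrow> real ^ 'n" where
  "basis_transform es vs x = (\<Sum>i<CARD('n). x $ (es ! i) *\<^sub>R vs ! i)"

lemma linear_basis_transform: "linear (basis_transform es vs)"
  unfolding basis_transform_def
  by (intro linearI) (simp_all add: scaleR_add_left sum.distrib scaleR_sum_right)

lemma length_ordered_basis:
  fixes vs :: "(real ^ 'n) list"
  assumes "ordered_basis vs" shows "length vs = CARD('n)"
proof -
  have "length vs = card (set vs)" using assms by (simp add: ordered_basis_def distinct_card)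
  also have "\<dots> = dim (UNIV :: (real ^ 'n) set)"
    using assms basis_card_eq_dim[of "set vs" UNIV] by (simp add: ordered_basis_def)
  finally show ?thesis by simp
qed

lemma inj_basis_transform:
  fixes vs :: "(real ^ 'n) list"
  assumes vs: "ordered_basis vs" and es: "distinct es" "length es = CARD('n)"
  shows "inj (basis_transform es vs)"
proof -
  have lin: "linear (basis_transform es vs)" by (rule linear_basis_transform)
  have "v \<in> range (basis_transform es vs)" if v: "v \<in> set vs" for v
  proof -
    obtain k where k: "k < CARD('n)" "v = vs ! k"
      using v length_ordered_basis[OF vs] by (metis in_set_conv_nth)
    have "basis_transform es vs (axis (es ! k) 1) = (\<Sum>i<CARD('n). if i = k then vs ! i else 0)"
      unfolding basis_transform_def
    proof (intro sum.cong refl)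
      fix i assume "i \<in> {..<CARD('n)}"
      then have "es ! i = es ! k \<longleftrightarrow> i = k" using k es by (simp add: nth_eq_iff_index_eq)
      then show "axis (es ! k) 1 $ (es ! i) *\<^sub>R vs ! i = (if i = k then vs ! i else 0)"
        by (simp add: axis_def)
    qed
    also have "\<dots> = v" using k by simp
    finally show ?thesis by (metis rangeI)
  qed
  then have "span (set vs) \<subseteq> range (basis_transform es vs)"
    using lin by (intro span_minimal linear_subspace_image) auto
  then have "surj (basis_transform es vs)" using vs by (auto simp: ordered_basis_def)
  then show ?thesis using lin by (simp add: linear_surjective_imp_injective)
qed

text \<open>The common value of all bases is the integral of \<open>f\<close> itself along some
  fixed numbering \<open>es\<close> of the coordinates, where \<open>vs\<close> does not occur. The
  point 0 is immaterial because every coordinate is integrated out.\<close>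

lemma schanuel_basis_independent:
  fixes vs :: "(real ^ 'n) list"
  assumes vs: "ordered_basis vs" and es: "distinct es" "set es = (UNIV :: 'n set)" and f: "sign_determined f"
  shows "schanuel_integrable vs f" and "schanuel_integral vs f = integrate_coords es f 0"
proof -
  have len: "length es = CARD('n)" using es distinct_card by metis
  let ?T = "basis_transform es vs"
  have fT: "sign_determined (f \<circ> ?T)" by (rule sign_determined_linear[OF f linear_basis_transform])
  have g: "(f \<circ> basis_map vs) as = (f \<circ> ?T) (vec_of_list es as)" if "length as = length es" for as
    using that len es(1) by (simp add: basis_map_def basis_transform_def vec_of_list_nth)
  note iter = schanuel_iterate_eq_integrate_coords[of es "f \<circ> basis_map vs" "f \<circ> ?T", OF g]
  show "schanuel_integrable vs f"
    unfolding schanuel_integrable_def schanuel_integrable_std_def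
  proof (intro ballI allI impI)
    fix k and as :: "real list" assume k: "k \<in> {1..CARD('n)}" and as: "length as = k - 1"
    have iter_k: "(\<lambda>x. schanuel_iterate (CARD('n) - k) (f \<circ> basis_map vs) (as @ [x])) =
        (\<lambda>x. integrate_coords (drop k es) (f \<circ> ?T) (upd (es ! (k - 1)) (vec_of_list es as) x))"
    proof
      fix x
      have "length as < length es" using k as len by auto
      from vec_of_list_snoc[OF this, of x]
      show "schanuel_iterate (CARD('n) - k) (f \<circ> basis_map vs) (as @ [x]) =
          integrate_coords (drop k es) (f \<circ> ?T) (upd (es ! (k - 1)) (vec_of_list es as) x)"
        using iter[of "CARD('n) - k" "as @ [x]"] k as len by simp
    qed
    obtain Z where "step_fun Z (\<lambda>x. integrate_coords (drop k es) (f \<circ> ?T) (upd (es ! (k - 1)) (vec_of_list es as) x))"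
      using sign_determined_step[OF sign_determined_integrate_coords[OF fT]] by blast
    then show "schanuel_integrable1 (\<lambda>x. schanuel_iterate (CARD('n) - k) (f \<circ> basis_map vs) (as @ [x]))"
      unfolding iter_k by (rule step_fun_integrable)
  qed
  have "schanuel_integral vs f = integrate_coords es (f \<circ> ?T) 0"
    unfolding schanuel_integral_def schanuel_integral_std_def
    using iter[of "CARD('n)" "[]"] len by (simp add: vec_of_list_def)
  also have "\<dots> = integrate_coords es f 0"
    by (rule integrate_all_linear_invariant[OF linear_basis_transform es inj_basis_transform[OF vs es(1) len] f])
  finally show "schanuel_integral vs f = integrate_coords es f 0" .
qed

theorem theorem1p1:
  fixes A :: "(real ^ 'n) set" and v w :: "(real ^ 'n) list"
  assumes "semialgebraic A" and "ordered_basis v" and "ordered_basis w"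
  shows "schanuel_integrable v (indicator A) \<and> schanuel_integrable w (indicator A) \<and>
         schanuel_integral v (indicator A) = schanuel_integral w (indicator A)"
proof -
  obtain es where "distinct es" "set es = (UNIV :: 'n set)"
    using finite_distinct_list[of "UNIV :: 'n set"] by auto
  then show ?thesis
    using schanuel_basis_independent[OF _ _ _ sign_determined_indicator[OF assms(1)]] assms(2,3) by metis
qed

end
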